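(* Let $p\neq 2$ be a prime and let $G$ be a transitive group of permutations of $\mathbb{Z}/p\cup\{\infty\}$. Suppose that $|G|=\frac{p^{3}-p}{2}$ and that $G$ contains all the translations $z\mapsto z+a$, $a\in\mathbb{Z}/p$. Then one of the following holds: (a) The map $z\mapsto -\frac{1}{z}$ is in $G$. (In this case $G$ is generated by $z\mapsto z+1$ and $z\mapsto -\frac1z$, and is permutation-isomorphic to $PSL_{2}(\mathbb{Z}/p)$ in its action on the set of 1-dimensional subspaces of $V=(\mathbb{Z}/p)^2$.) (b) $p=7$ and $G$ contains the involution $(0\ \infty)(1\ 3)(2\ 6)(4\ 5)$ or the involution $(0\ \infty)(1\ 5)(2\ 3)(4\ 6)$. In these cases $G$ is generated by $z\mapsto z+1$, $z\mapsto 2z$, and that involution, and $G$ has a normal subgroup of order $8$.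
   Context: $\mathbb{Z}/p\cup\{\infty\}$ is the set of $p+1$ elements obtained by adjoining a symbol $\infty$ to $\mathbb{Z}/p$. Maps $z\mapsto z+a$ and $z\mapsto az$ ($a\ne0$ in the latter) are regarded as permutations of $\mathbb{Z}/p\cup\{\infty\}$ fixing $\infty$; the map $z\mapsto -\frac1z$ interchanges $0$ and $\infty$. $PSL_2(\mathbb{Z}/p)=SL_2(\mathbb{Z}/p)/\{\pm I\}$ acts on the $p+1$ one-dimensional subspaces of the space $V$ of column vectors of length 2 over $\mathbb{Z}/p$. Two permutation groups, on sets $S$ and $S'$, are permutation-isomorphic if there is a bijection $S\to S'$ carrying one group onto the other. *)

theory Defs
  imports
    "HOL-Analysis.Analysis"
    "HOL-Algebra.Algebra"
    "HOL-Combinatorics.Transposition"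
    "Berlekamp_Zassenhaus.Finite_Field"
begin

text \<open>
  The prime \<open>p\<close> is \<open>CARD('p)\<close> for an arbitrary type \<open>'p\<close> of class \<open>prime_card\<close> (whose sole axiom
  is that its cardinality is prime), and \<open>'p mod_ring\<close> is the field \<open>\<int>/p\<close>.
  The set \<open>\<int>/p \<union> {\<infinity>}\<close> is the type \<open>'p mod_ring option\<close>, with \<open>None\<close> in the role of \<open>\<infinity>\<close>.

  A group of permutations of a set \<open>S\<close> is a subgroup of \<open>BijGroup S\<close>, whose elements are the
  bijections of \<open>S\<close> extended by \<open>undefined\<close> outside \<open>S\<close>.
\<close>

type_synonym 'p zp_inf = "'p mod_ring option"

definition translation :: "'p mod_ring \<Rightarrow> 'p::prime_card zp_inf \<Rightarrow> 'p zp_inf" where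
  "translation a = map_option (\<lambda>z. z + a)"

definition dilation :: "'p mod_ring \<Rightarrow> 'p::prime_card zp_inf \<Rightarrow> 'p zp_inf" where
  "dilation a = map_option (\<lambda>z. a * z)"

definition neg_recip :: "'p::prime_card zp_inf \<Rightarrow> 'p zp_inf" where
  "neg_recip x = (case x of None \<Rightarrow> Some 0
                          | Some z \<Rightarrow> if z = 0 then None else Some (- (1 / z)))"

text \<open>The involutions \<open>(0 \<infinity>)(1 3)(2 6)(4 5)\<close> and \<open>(0 \<infinity>)(1 5)(2 3)(4 6)\<close>, used only for \<open>p = 7\<close>.\<close>

definition invol1 :: "'p::prime_card zp_inf \<Rightarrow> 'p zp_inf" where
  "invol1 = Transposition.transpose (Some 0) None \<circ> Transposition.transpose (Some 1) (Some 3)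
          \<circ> Transposition.transpose (Some 2) (Some 6) \<circ> Transposition.transpose (Some 4) (Some 5)"

definition invol2 :: "'p::prime_card zp_inf \<Rightarrow> 'p zp_inf" where
  "invol2 = Transposition.transpose (Some 0) None \<circ> Transposition.transpose (Some 1) (Some 5)
          \<circ> Transposition.transpose (Some 2) (Some 3) \<circ> Transposition.transpose (Some 4) (Some 6)"

definition transitive_on :: "'a set \<Rightarrow> ('a \<Rightarrow> 'a) set \<Rightarrow> bool" where
  "transitive_on S G \<longleftrightarrow> (\<forall>x\<in>S. \<forall>y\<in>S. \<exists>g\<in>G. g x = y)"

text \<open>
  The conjugate \<open>\<phi> g \<phi>\<^sup>-\<^sup>1\<close> is restricted to \<open>S'\<close> to match the extensional functions in \<open>BijGroup S'\<close>.
\<close>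

definition perm_isomorphic ::
  "'a set \<Rightarrow> ('a \<Rightarrow> 'a) set \<Rightarrow> 'b set \<Rightarrow> ('b \<Rightarrow> 'b) set \<Rightarrow> bool" where
  "perm_isomorphic S G S' G' \<longleftrightarrow>
     (\<exists>\<phi>. bij_betw \<phi> S S' \<and> (\<lambda>g. \<lambda>y\<in>S'. \<phi> (g (inv_into S \<phi> y))) ` G = G')"

definition SL2 :: "('p::prime_card mod_ring ^ 2 ^ 2) monoid" where
  "SL2 = \<lparr>carrier = {A. det A = 1}, mult = (**), one = mat 1\<rparr>"

definition PSL2 :: "('p::prime_card mod_ring ^ 2 ^ 2) set monoid" where
  "PSL2 = SL2 Mod {mat 1, - mat 1}"

definition lines :: "('p::prime_card mod_ring ^ 2) set set" where
  "lines = {L. vec.subspace L \<and> vec.dim L = 1}"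

text \<open>
  An element of \<open>PSL2\<close> is a coset \<open>C = {A, - A}\<close>. Both of its members map a line \<open>L\<close> onto the
  same line, so the union below is just the image of \<open>L\<close> under either of them.
\<close>

definition PSL2_action ::
  "('p::prime_card mod_ring ^ 2 ^ 2) set \<Rightarrow> ('p mod_ring ^ 2) set \<Rightarrow> ('p mod_ring ^ 2) set" where
  "PSL2_action C = (\<lambda>L\<in>lines. \<Union>A\<in>C. (\<lambda>v. A *v v) ` L)"

definition PSL2_perms :: "(('p::prime_card mod_ring ^ 2) set \<Rightarrow> ('p mod_ring ^ 2) set) set" where
  "PSL2_perms = PSL2_action ` carrier PSL2"

end

theory Submission
  imports Defs
begin

text \<open>
  Write \<open>p = 2 m + 1\<close> and call \<open>a \<in> \<int>/p\<close> a residue if \<open>a ^ m = 1\<close>; these are the nonzero squares.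

  The stabilizer of \<open>\<infinity>\<close> has order \<open>p m < p\<^sup>2\<close>, so it cannot contain two different conjugates of the
  translation group. It therefore normalizes the translations, hence consists of affine maps, and
  counting shows that it is \<open>{z \<mapsto> a z + b | a a residue}\<close>. Some \<open>t \<in> G\<close> interchanges \<open>0\<close> and \<open>\<infinity>\<close>;
  let \<open>T\<close> be its action on the nonzero elements. Conjugation by \<open>t\<close> permutes the dilations by
  residues, so \<open>T (s x) = \<sigma> s * T x\<close> for residues \<open>s\<close>, where \<open>\<sigma>\<close> is an automorphism of order at most
  two of the cyclic group of residues: \<open>\<sigma> s = s ^ e\<close>. All further information on \<open>T\<close> comes from the
  relation \<open>bruhat\<close>, which rewrites \<open>t \<circ> translation b \<circ> t\<close> for \<open>b \<noteq> 0\<close> as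
  \<open>translation (T b) \<circ> dilation (k b) \<circ> t \<circ> translation (- c b)\<close> with a residue \<open>k b\<close> and with
  \<open>T (c b) = - b\<close>.

  If \<open>\<sigma>\<close> is not the identity, then \<open>T x = C / x\<close>
  (lemma \<open>eq_reciprocal_if_nontrivial\<close>). The idea is representation theory in
  characteristic \<open>p\<close>. Inducing the character \<open>a \<mapsto> a ^ j\<close> of the stabilizer of \<open>\<infinity>\<close> to \<open>G\<close> gives a module
  whose elements are functions on \<open>\<int>/p\<close> together with a value at \<open>\<infinity>\<close>; summation over the double coset
  of \<open>t\<close> is a homomorphism from it to the module induced from the conjugate character. In coordinates
  this homomorphism is convolution with \<open>q y = k (- T y) ^ j\<close>. For a suitable \<open>j\<close> this \<open>q\<close> is a
  polynomial of degree \<open>p - 1 - D\<close> with \<open>2 \<le> D < m\<close>, convolution with it lowers degrees by \<open>D\<close>, and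
  so the functions in the kernel are polynomials of degree at most \<open>D\<close>. The kernel is stable under \<open>t\<close>, which
  means that \<open>t\<close> maps the monomials of small degree to monomials of small degree. Their exponents are
  in arithmetic progression with difference \<open>e\<close> modulo \<open>m\<close> and fill an interval shorter than \<open>m\<close>;
  this leaves only \<open>e = -1\<close>, and comparison of the first two of these monomials gives \<open>c x = A / x\<close>.

  If \<open>\<sigma>\<close> is the identity, then \<open>T\<close> is linear on the residues and linear on the nonresidues, and the
  same relation becomes a linear equation that has too few solutions unless \<open>m \<le> 3\<close>
  (lemma \<open>trivial_\<sigma>_cases\<close>); the case \<open>m = 3\<close> is the exceptional one with \<open>p = 7\<close>.

  When \<open>T x = C / x\<close>, the relation shows that \<open>- C = k 1\<close> is a residue, so \<open>z \<mapsto> -1/z\<close> lies in \<open>G\<close>. The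
  assertions on generators follow because \<open>G\<close> is the union of the affine maps in it and one double
  coset (\<open>bruhat_decomposition\<close>), and because the relation produces the dilations from \<open>z \<mapsto> -1/z\<close> and
  the translations. The isomorphism with \<open>PSL2\<close> sends \<open>z\<close> to the line through \<open>(z, 1)\<close> and \<open>\<infinity>\<close> to the
  line through \<open>(1, 0)\<close>. In the exceptional case \<open>k b = 1\<close> for all \<open>b\<close>, and then the identity and
  the seven conjugates of \<open>t\<close> by translations are closed under composition; they form the normal
  subgroup of order \<open>8\<close>.
\<close>

section \<open>Powers and power sums modulo p\<close>

hide_const (open) Polynomials.degree Polynomials.lead_coeff up_ring.coeff up_ring.monom

lemma power_half_cases:
  fixes x :: "'p::prime_card mod_ring"
  assumes card: "CARD('p) = 2 * m + 1" and "x \<noteq> 0"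
  shows "x ^ m = 1 \<or> x ^ m = -1" and "x ^ (2 * m) = 1"
proof -
  have "x * x ^ (2 * m) = x"
    using finite_field_power_card_eq_same[of x] card by simp
  then show *: "x ^ (2 * m) = 1"
    using \<open>x \<noteq> 0\<close> by (metis mult_cancel_left1)
  then have "(x ^ m - 1) * (x ^ m + 1) = 0"
    by (simp add: algebra_simps power2_eq_square flip: power_add mult_2)
  then show "x ^ m = 1 \<or> x ^ m = -1"
    by (simp add: eq_neg_iff_add_eq_0)
qed

lemma card_roots_le:
  fixes P :: "'p::prime_card mod_ring poly"
  assumes "\<And>x. x \<in> S \<Longrightarrow> poly P x = 0" and "degree P < card S"
  shows "P = 0"
proof (rule ccontr)
  assume "P \<noteq> 0"
  have "card S \<le> card {x. poly P x = 0}"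
    by (rule card_mono) (use assms(1) in auto)
  also have "\<dots> \<le> degree P"
    by (rule card_poly_roots_bound) fact
  finally show False using assms(2) by simp
qed

lemma card_nonzero: "card (UNIV - {0 :: 'p::prime_card mod_ring}) = CARD('p) - 1"
  by (simp add: card_Diff_subset)

lemma exists_power_neq_1:
  assumes "0 < n" "n < CARD('p::prime_card) - 1"
  shows "\<exists>x :: 'p mod_ring. x \<noteq> 0 \<and> x ^ n \<noteq> 1"
proof (rule ccontr)
  assume *: "\<not> ?thesis"
  have "monom 1 n - 1 = (0 :: 'p mod_ring poly)"
  proof (rule card_roots_le[of "UNIV - {0}"])
    show "degree (monom 1 n - 1 :: 'p mod_ring poly) < card (UNIV - {0 :: 'p mod_ring})"
      using assms by (intro le_less_trans[OF degree_diff_le[of _ n]]) (auto simp: degree_monom_le card_nonzero)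
  qed (use * in \<open>auto simp: poly_monom\<close>)
  then have "coeff (monom 1 n - 1 :: 'p mod_ring poly) n = 0" by simp
  then show False using assms by (simp add: coeff_1)
qed

lemma sum_powers:
  assumes "0 < n" "n < 2 * (CARD('p::prime_card) - 1)"
  shows "(\<Sum>y\<in>UNIV. (y :: 'p mod_ring) ^ n) = (if n = CARD('p) - 1 then -1 else 0)"
proof -
  define q where "q = CARD('p) - 1"
  have q: "CARD('p) = Suc q" using prime_gt_1_nat[OF prime_card[where 'a='p]] by (simp add: q_def)
  have one: "y ^ q = 1" if "y \<noteq> 0" for y :: "'p mod_ring"
  proof -
    have "y * y ^ q = y" using finite_field_power_card_eq_same[of y] q by simp
    then show ?thesis using that by (metis mult_cancel_left1)
  qed
  have small: "(\<Sum>y\<in>UNIV. (y :: 'p mod_ring) ^ k) = 0" if k: "0 < k" "k < q" for k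
  proof -
    obtain x :: "'p mod_ring" where x: "x \<noteq> 0" "x ^ k \<noteq> 1"
      using exists_power_neq_1[where 'p='p] k by (auto simp: q_def)
    have "(\<Sum>y\<in>UNIV. (x * y) ^ k) = (\<Sum>y\<in>UNIV. y ^ k)"
      by (rule sum.reindex_bij_witness[of _ "\<lambda>y. y / x" "\<lambda>y. x * y"]) (use x in auto)
    then have "(x ^ k - 1) * (\<Sum>y\<in>UNIV. y ^ k) = 0"
      by (simp add: power_mult_distrib left_diff_distrib flip: sum_distrib_left)
    then show ?thesis using x by simp
  qed
  have "n < q \<or> n = q \<or> q < n" by auto
  then show ?thesis
  proof (elim disjE)
    assume "n < q" then show ?thesis using small assms q by auto
  next
    assume n: "n = q"
    have "(\<Sum>y\<in>UNIV. (y :: 'p mod_ring) ^ n) = (\<Sum>y\<in>UNIV - {0}. y ^ n)"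
      by (rule sum.mono_neutral_right) (use assms in auto)
    also have "\<dots> = (\<Sum>y\<in>UNIV - {0 :: 'p mod_ring}. 1)"
      by (rule sum.cong) (use one n in auto)
    also have "\<dots> = of_nat q" by (simp add: card_nonzero q_def)
    also have "\<dots> = of_nat (CARD('p)) - 1" by (simp only: q of_nat_Suc) simp
    also have "\<dots> = -1" by (simp only: of_nat_card_eq_0) simp
    finally show ?thesis using n by (simp add: q_def)
  next
    assume n: "q < n"
    have "(y :: 'p mod_ring) ^ n = y ^ (n - q)" for y
    proof (cases "y = 0")
      case False
      have "y ^ n = y ^ q * y ^ (n - q)" using n by (simp flip: power_add)
      then show ?thesis using one[OF False] by simp
    qed (use n assms in \<open>simp add: power_0_left\<close>)
    then have "(\<Sum>y\<in>UNIV. (y :: 'p mod_ring) ^ n) = (\<Sum>y\<in>UNIV. y ^ (n - q))" by simp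
    also have "\<dots> = 0" using small n assms by (simp add: q_def)
    finally show ?thesis using n q by simp
  qed
qed

text \<open>
  Up to sign, convolution with \<open>y ^ d\<close> is the divided derivative of order \<open>p - 1 - d\<close>: in the binomial
  expansion only the summand in which \<open>y\<close> has exponent \<open>p - 1\<close> survives the sum over \<open>y\<close>. The bound on
  \<open>d + i\<close> excludes the next multiple of \<open>p - 1\<close>.
\<close>

lemma sum_power_mult_power_diff:
  fixes x :: "'p::prime_card mod_ring"
  assumes "0 < d" "d \<le> CARD('p) - 1" "d + i < 2 * (CARD('p) - 1)"
  shows "(\<Sum>y\<in>UNIV. y ^ d * (x - y) ^ i) =
    - ((-1) ^ (CARD('p) - 1 - d) * of_nat (i choose (CARD('p) - 1 - d)) * x ^ (i - (CARD('p) - 1 - d)))"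
proof -
  let ?l = "CARD('p) - 1 - d"
  have "y ^ d * (x - y) ^ i = (\<Sum>l\<le>i. of_nat (i choose l) * (-1) ^ l * x ^ (i - l) * y ^ (d + l))" for y
  proof -
    have "(x - y) ^ i = (- y + x) ^ i" by simp
    also have "\<dots> = (\<Sum>l\<le>i. of_nat (i choose l) * (- y) ^ l * x ^ (i - l))"
      by (rule binomial_ring)
    also have "y ^ d * \<dots> = (\<Sum>l\<le>i. of_nat (i choose l) * (-1) ^ l * x ^ (i - l) * y ^ (d + l))"
      unfolding sum_distrib_left
      by (rule sum.cong) (auto simp: power_add power_minus[of y] mult_ac)
    finally show ?thesis .
  qed
  then have "(\<Sum>y\<in>UNIV. y ^ d * (x - y) ^ i) =
     (\<Sum>y\<in>UNIV. \<Sum>l\<le>i. of_nat (i choose l) * (-1) ^ l * x ^ (i - l) * y ^ (d + l))" by simp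
  also have "\<dots> = (\<Sum>l\<le>i. \<Sum>y\<in>UNIV. of_nat (i choose l) * (-1) ^ l * x ^ (i - l) * y ^ (d + l))"
    by (rule sum.swap)
  also have "\<dots> = (\<Sum>l\<le>i. of_nat (i choose l) * (-1) ^ l * x ^ (i - l) * (\<Sum>y\<in>UNIV. y ^ (d + l)))"
    by (simp add: sum_distrib_left)
  also have "\<dots> = (\<Sum>l\<le>i. if l = ?l then of_nat (i choose l) * (-1) ^ l * x ^ (i - l) * (-1) else 0)"
    by (rule sum.cong) (use assms in \<open>auto simp: sum_powers\<close>)
  also have "\<dots> = (if ?l \<le> i then of_nat (i choose ?l) * (-1) ^ ?l * x ^ (i - ?l) * (-1) else 0)"
    by (simp add: sum.delta)
  also have "\<dots> = - ((-1) ^ ?l * of_nat (i choose ?l) * x ^ (i - ?l))"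
    by (auto simp: binomial_eq_0)
  finally show ?thesis .
qed

lemma of_nat_binomial_neq_0:
  assumes "n < CARD('p::prime_card)" "k \<le> n"
  shows "of_nat (n choose k) \<noteq> (0 :: 'p mod_ring)"
proof
  assume "of_nat (n choose k) = (0 :: 'p mod_ring)"
  then have "CARD('p) dvd n choose k" by (rule of_nat_0_mod_ring_dvd)
  then have "CARD('p) dvd fact n"
    using binomial_fact_lemma[OF assms(2)] by (metis dvd_mult)
  then show False
    using assms by (simp add: prime_dvd_fact_iff prime_card)
qed

lemma nonresidue_exists:
  assumes card: "CARD('p::prime_card) = 2 * m + 1" and "0 < m"
  shows "\<exists>n :: 'p mod_ring. n ^ m = -1 \<and> n \<noteq> 0"
  using exists_power_neq_1[of m, where 'p='p] power_half_cases(1)[OF card] assms by auto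

lemma one_neq_minus_one:
  assumes card: "CARD('p::prime_card) = 2 * m + 1" and "0 < m"
  shows "(1 :: 'p mod_ring) \<noteq> -1" and "(2 :: 'p mod_ring) \<noteq> 0"
proof -
  show *: "(2 :: 'p mod_ring) \<noteq> 0"
  proof
    assume "(2 :: 'p mod_ring) = 0"
    then have "of_nat 2 = (0 :: 'p mod_ring)" by simp
    from of_nat_0_mod_ring_dvd[OF this] show False using assms by (auto dest: dvd_imp_le)
  qed
  then show "(1 :: 'p mod_ring) \<noteq> -1"
    by (metis add.right_inverse one_add_one)
qed

lemma card_residues:
  assumes card: "CARD('p::prime_card) = 2 * m + 1" and m: "0 < m"
  shows "card {a :: 'p mod_ring. a ^ m = 1} = m"
    and "(a :: 'p mod_ring) ^ m = 1 \<Longrightarrow> \<exists>b. b \<noteq> 0 \<and> a = b ^ 2"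
proof -
  let ?K = "{a :: 'p mod_ring. a ^ m = 1}" and ?S = "(\<lambda>b. b ^ 2) ` (UNIV - {0 :: 'p mod_ring})"
  have sub: "?S \<subseteq> ?K"
    using power_half_cases(2)[OF card] by (auto simp flip: power_mult)
  have le: "card ?K \<le> m"
  proof (rule ccontr)
    assume *: "\<not> card ?K \<le> m"
    have "monom 1 m - 1 = (0 :: 'p mod_ring poly)"
    proof (rule card_roots_le[of ?K])
      show "degree (monom 1 m - 1 :: 'p mod_ring poly) < card ?K"
        using * by (intro le_less_trans[OF degree_diff_le[of _ m]]) (auto simp: degree_monom_le)
    qed (auto simp: poly_monom)
    then have "coeff (monom 1 m - 1 :: 'p mod_ring poly) m = 0" by simp
    then show False using m by (simp add: coeff_1)
  qed
  have "card (UNIV - {0 :: 'p mod_ring}) \<le> card ?S * 2"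
  proof -
    have "UNIV - {0 :: 'p mod_ring} = (\<Union>s\<in>?S. {b. b \<noteq> 0 \<and> b ^ 2 = s})" by auto
    also have "card \<dots> \<le> (\<Sum>s\<in>?S. card {b. b \<noteq> 0 \<and> b ^ 2 = s})"
      by (rule card_UN_le) simp
    also have "\<dots> \<le> (\<Sum>s\<in>?S. 2)"
    proof (rule sum_mono)
      fix s assume "s \<in> ?S"
      then obtain c where "s = c ^ 2" by auto
      then have "{b. b \<noteq> 0 \<and> b ^ 2 = s} \<subseteq> {c, - c}" by (auto simp: power2_eq_iff)
      then show "card {b. b \<noteq> 0 \<and> b ^ 2 = s} \<le> 2"
        using card_mono[of "{c, - c}" "{b. b \<noteq> 0 \<and> b ^ 2 = s}"] card_insert_le_m1[of 2 "{- c}" c] by simp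
    qed
    finally show ?thesis by simp
  qed
  then have ge: "m \<le> card ?S" using card by (simp add: card_nonzero)
  then have eq: "?S = ?K"
    using sub le by (intro card_seteq) auto
  then show "card ?K = m" using le ge by auto
  show "\<exists>b. b \<noteq> 0 \<and> a = b ^ 2" if "a ^ m = 1"
  proof -
    have "a \<in> ?S" unfolding eq using that by simp
    then show ?thesis by auto
  qed
qed

lemma ex_primitive_root: "\<exists>g :: 'p::prime_card mod_ring. g \<noteq> 0 \<and> (\<forall>x. x \<noteq> 0 \<longrightarrow> (\<exists>i. x = g ^ i))"
proof -
  let ?R = "\<lparr>carrier = UNIV, monoid.mult = (*), one = 1, ring.zero = 0, add = (+)\<rparr> :: 'p mod_ring ring"
  have "\<exists>y. x + y = 0" for x :: "'p mod_ring"
    by (rule exI[of _ "- x"]) simp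
  moreover have "x \<noteq> 0 \<Longrightarrow> \<exists>y. x * y = 1" for x :: "'p mod_ring"
    by (rule exI[of _ "inverse x"]) simp
  ultimately interpret R: field ?R
    by unfold_locales (auto simp: algebra_simps Units_def)
  have pow: "a [^]\<^bsub>?R\<^esub> (i :: nat) = a ^ i" for a :: "'p mod_ring" and i
    by (induction i) (auto simp: nat_pow_def mult.commute)
  have c: "carrier (mult_of ?R) = UNIV - {0}" by auto
  obtain a where "a \<in> carrier (mult_of ?R)" "carrier (mult_of ?R) = {a [^]\<^bsub>?R\<^esub> i | i :: nat. i \<in> UNIV}"
    using R.finite_field_mult_group_has_gen by auto
  then show ?thesis unfolding c pow by (intro exI[of _ a]) auto
qed

text \<open>
  The residues are the powers of the square of a primitive root, so an endomorphism of the group of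
  residues is determined by its value at that square.
\<close>

lemma multiplicative_on_residues:
  fixes \<sigma> :: "'p::prime_card mod_ring \<Rightarrow> 'p mod_ring"
  assumes card: "CARD('p) = 2 * m + 1" and m: "0 < m"
    and mult: "\<And>a b. a ^ m = 1 \<Longrightarrow> b ^ m = 1 \<Longrightarrow> \<sigma> (a * b) = \<sigma> a * \<sigma> b"
    and into: "\<And>a. a ^ m = 1 \<Longrightarrow> \<sigma> a ^ m = 1"
  shows "\<exists>e<m. \<forall>a. a ^ m = 1 \<longrightarrow> \<sigma> a = a ^ e"
proof -
  obtain g :: "'p mod_ring" where g: "g \<noteq> 0" "\<And>x. x \<noteq> 0 \<Longrightarrow> \<exists>i. x = g ^ i"
    using ex_primitive_root by blast
  define h where "h = g ^ 2"
  have h: "h ^ m = 1" unfolding h_def using power_half_cases(2)[OF card g(1)] by (simp flip: power_mult)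
  have hi: "(h ^ i) ^ m = 1" for i
    using h by (simp add: mult.commute[of i] power_mult flip: power_mult[of h i m])
  have gen: "\<exists>i. a = h ^ i" if a: "a ^ m = 1" for a
  proof -
    obtain b where "b \<noteq> 0" "a = b ^ 2" using card_residues(2)[OF card m a] by auto
    moreover obtain i where "b = g ^ i" using g(2) calculation by blast
    ultimately have "a = h ^ i" unfolding h_def by (simp add: mult.commute flip: power_mult)
    then show ?thesis ..
  qed
  have s1: "\<sigma> 1 = 1"
  proof -
    have "\<sigma> 1 * (\<sigma> 1 - 1) = 0" using mult[of 1 1] by (simp add: algebra_simps)
    moreover have "\<sigma> 1 \<noteq> 0" using into[of 1] m by (auto simp: power_0_left)
    ultimately show ?thesis by simp
  qed
  obtain f where f: "\<sigma> h = h ^ f" using gen into h by blast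
  have sp: "\<sigma> (h ^ i) = (h ^ i) ^ f" for i
    by (induction i) (auto simp: s1 mult h hi f power_mult_distrib)
  have "(h ^ i) ^ (f mod m) = (h ^ i) ^ f" for i
  proof -
    have "(h ^ i) ^ f = ((h ^ i) ^ m) ^ (f div m) * (h ^ i) ^ (f mod m)"
      unfolding power_mult[symmetric, of "h ^ i"] power_add[symmetric, of "h ^ i"] by simp
    then show ?thesis by (simp add: hi)
  qed
  then have "\<sigma> a = a ^ (f mod m)" if "a ^ m = 1" for a
    using gen[OF that] sp by auto
  then show ?thesis using m by (intro exI[of _ "f mod m"]) simp
qed

text \<open>
  There are only two cosets of the residues, so the functions with this homogeneity that vanish at \<open>0\<close>
  form a space of dimension two. Since \<open>x ^ m = \<plusminus>1\<close>, the monomials \<open>x ^ w\<close> and \<open>x ^ (w + m)\<close> span it.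
  The exponent \<open>w\<close> matters only modulo \<open>m\<close>, and \<open>w > 0\<close> makes both monomials vanish at \<open>0\<close>.
\<close>

lemma homogeneous_eq_two_monomials:
  fixes f :: "'p::prime_card mod_ring \<Rightarrow> 'p mod_ring"
  assumes card: "CARD('p) = 2 * m + 1" and m: "0 < m" and w: "0 < w"
    and f0: "f 0 = 0" and hom: "\<And>s x. s ^ m = 1 \<Longrightarrow> f (s * x) = s ^ w * f x"
  shows "\<exists>a b. \<forall>x. f x = a * x ^ w + b * x ^ (w + m)"
proof -
  obtain n :: "'p mod_ring" where n: "n ^ m = -1" "n \<noteq> 0" using nonresidue_exists[OF card m] by auto
  have two: "(2 :: 'p mod_ring) \<noteq> 0" using one_neq_minus_one[OF card m] by auto
  define u v where "u = f 1" and "v = f n / n ^ w"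
  have "f x = (u + v) / 2 * x ^ w + (u - v) / 2 * x ^ (w + m)" for x
  proof (cases "x = 0")
    case False
    from power_half_cases(1)[OF card this] show ?thesis
    proof
      assume x: "x ^ m = 1"
      have "f x = x ^ w * u" using hom[OF x, of 1] by (simp add: u_def)
      then show ?thesis using two x by (simp add: field_simps power_add)
    next
      assume x: "x ^ m = -1"
      have "(x / n) ^ m = 1" using x n by (simp add: power_divide)
      from hom[OF this, of n] have "f x = x ^ w * v" using n by (simp add: v_def power_divide)
      then show ?thesis using two x by (simp add: field_simps power_add)
    qed
  qed (use f0 w in \<open>simp add: power_0_left\<close>)
  then show ?thesis by blast
qed

section \<open>Convolution and degrees\<close>

text \<open>
  With \<open>D = m - d\<close>, the function \<open>q\<close> is a polynomial of degree \<open>p - 1 - D\<close>, so convolution with \<open>q\<close> combines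
  the divided derivatives of orders \<open>D\<close> and \<open>D + m\<close>.
\<close>

context
  fixes m d :: nat and q :: "'p::prime_card mod_ring \<Rightarrow> 'p mod_ring" and C0 C1 :: "'p mod_ring"
  assumes card: "CARD('p) = 2 * m + 1" and d: "0 < d" "d < m" and C1: "C1 \<noteq> 0"
    and q: "\<And>y. q y = C0 * y ^ d + C1 * y ^ (d + m)"
begin

lemma sum_convolution_monomial:
  assumes "w \<le> 2 * m"
  shows "(\<Sum>y\<in>UNIV. q y * (x - y) ^ w) =
    - (C0 * ((-1) ^ (2 * m - d) * of_nat (w choose (2 * m - d))) * x ^ (w - (2 * m - d)))
    - C1 * ((-1) ^ (m - d) * of_nat (w choose (m - d))) * x ^ (w - (m - d))"
proof -
  have "(\<Sum>y\<in>UNIV. q y * (x - y) ^ w) = (\<Sum>y\<in>UNIV. C0 * (y ^ d * (x - y) ^ w) + C1 * (y ^ (d + m) * (x - y) ^ w))"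
    by (rule sum.cong) (simp_all add: q algebra_simps)
  also have "\<dots> = C0 * (\<Sum>y\<in>UNIV. y ^ d * (x - y) ^ w) + C1 * (\<Sum>y\<in>UNIV. y ^ (d + m) * (x - y) ^ w)"
    by (simp add: sum.distrib sum_distrib_left)
  also have "(\<Sum>y\<in>UNIV. y ^ d * (x - y) ^ w) =
      - ((-1) ^ (2 * m - d) * of_nat (w choose (2 * m - d)) * x ^ (w - (2 * m - d)))"
    using sum_power_mult_power_diff[of d w x] card d assms by simp
  also have "(\<Sum>y\<in>UNIV. y ^ (d + m) * (x - y) ^ w) =
      - ((-1) ^ (m - d) * of_nat (w choose (m - d)) * x ^ (w - (m - d)))"
  proof -
    have "CARD('p) - 1 - (d + m) = m - d" using card by simp
    then show ?thesis using sum_power_mult_power_diff[of "d + m" w x] card d assms by simp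
  qed
  finally show ?thesis by (simp add: mult.assoc)
qed

lemma sum_convolution_eq_0:
  assumes "i < m - d"
  shows "(\<Sum>y\<in>UNIV. q y * (x - y) ^ i) = 0"
  using sum_convolution_monomial[of i x] assms d by (simp add: binomial_eq_0)

text \<open>
  Convolution turns \<open>b x ^ (w + m)\<close> into a nonzero multiple of a nonconstant monomial which no other
  term can cancel, so \<open>b = 0\<close>; then \<open>a x ^ w\<close> is mapped to a constant only if \<open>w \<le> m - d\<close>. Both
  conclusions compare coefficients of a polynomial of degree less than \<open>p - 1\<close>.
\<close>

lemma degree_bound_of_convolution:
  assumes f: "\<And>x. f x = a * x ^ w + b * x ^ (w + m)" and w: "0 < w" "w \<le> m"
    and r: "\<And>x. x \<noteq> 0 \<Longrightarrow> (\<Sum>y\<in>UNIV. q y * f (x - y)) = r"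
  shows "b = 0" and "a = 0 \<or> w < m - d \<or> (w = m - d \<and> r \<noteq> 0)"
proof -
  let ?D = "m - d"
  define Z where "Z = - b * C1 * (-1) ^ ?D * of_nat ((w + m) choose ?D)"
  define Y where "Y = - (b * C0 * (-1) ^ (2 * m - d) * of_nat ((w + m) choose (2 * m - d)))
     - a * C1 * (-1) ^ ?D * of_nat (w choose ?D)"
  have wm: "w + m - (2 * m - d) = w - ?D" using d by simp
  have wc: "w choose (2 * m - d) = 0" using w d by (simp add: binomial_eq_0)
  have eq: "Z * x ^ (w + m - ?D) + Y * x ^ (w - ?D) = r" if "x \<noteq> 0" for x
  proof -
    have "r = (\<Sum>y\<in>UNIV. q y * f (x - y))" using r that by simp
    also have "\<dots> = (\<Sum>y\<in>UNIV. a * (q y * (x - y) ^ w) + b * (q y * (x - y) ^ (w + m)))"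
      by (rule sum.cong) (simp_all add: f algebra_simps)
    also have "\<dots> = a * (\<Sum>y\<in>UNIV. q y * (x - y) ^ w) + b * (\<Sum>y\<in>UNIV. q y * (x - y) ^ (w + m))"
      by (simp add: sum.distrib sum_distrib_left)
    also have "\<dots> = Z * x ^ (w + m - ?D) + Y * x ^ (w - ?D)"
    proof -
      have w2: "w \<le> 2 * m" "w + m \<le> 2 * m" using w by auto
      show ?thesis
        unfolding sum_convolution_monomial[OF w2(1)] sum_convolution_monomial[OF w2(2)] wm wc Z_def Y_def
        by (simp add: algebra_simps)
    qed
    finally show ?thesis by simp
  qed
  let ?P = "Polynomial.monom Z (w + m - ?D) + Polynomial.monom Y (w - ?D) - [:r:]"
  have P0: "?P = 0"
  proof (rule card_roots_le[of "UNIV - {0 :: 'p mod_ring}"])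
    show "poly ?P x = 0" if "x \<in> UNIV - {0}" for x
      using eq[of x] that by (simp add: poly_monom)
    have "degree ?P \<le> w + m - ?D"
      by (intro degree_diff_le degree_add_le order.trans[OF degree_monom_le]) auto
    also have "\<dots> < 2 * m" using w d by simp
    finally show "degree ?P < card (UNIV - {0 :: 'p mod_ring})"
      using card by (simp add: card_nonzero)
  qed
  have coeff: "coeff ?P n = 0" for n unfolding P0 by simp
  have nz: "of_nat (n choose k) \<noteq> (0 :: 'p mod_ring)" if "n \<le> 2 * m" "k \<le> n" for n k
    using of_nat_binomial_neq_0[of n k, where 'p='p] that card by simp
  have "Z = 0"
    using coeff[of "w + m - ?D"] w d by (simp add: coeff_pCons split: nat.splits if_splits)
  then show b: "b = 0"
    using nz[of "w + m" ?D] C1 w by (auto simp: Z_def)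
  show "a = 0 \<or> w < ?D \<or> (w = ?D \<and> r \<noteq> 0)"
  proof (cases "w < ?D")
    case False
    have a: "a = 0" if "Y = 0"
      using that nz[of w ?D] C1 w False by (auto simp: Y_def b)
    show ?thesis
    proof (cases "w = ?D")
      case True
      then show ?thesis using coeff[of 0] a \<open>Z = 0\<close> by auto
    next
      case neq: False
      then have "Y = 0"
        using coeff[of "w - ?D"] \<open>Z = 0\<close> False by (simp add: coeff_pCons split: nat.splits if_splits)
      then show ?thesis using a by simp
    qed
  qed simp
qed

end

text \<open>
  The values \<open>w 1, \<dots>, w (D - 1)\<close> exhaust \<open>{1, \<dots>, D - 1}\<close>, and each but the last exceeds its successor by
  \<open>a\<close> modulo \<open>m\<close>. If \<open>a \<ge> 2\<close>, then neither \<open>a\<close> nor \<open>a - 1\<close> can have a successor: it would have to be \<open>0\<close> or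
  \<open>-1\<close> modulo \<open>m\<close>, and the interval contains no such element because \<open>D < m\<close>.
\<close>

lemma interval_step_eq_1:
  fixes w :: "nat \<Rightarrow> nat"
  assumes D: "2 \<le> D" "D < m" and a: "0 < a" "a < D"
    and w: "\<And>i. 0 < i \<Longrightarrow> i < D \<Longrightarrow> 0 < w i \<and> w i < D"
    and step: "\<And>i. 0 < i \<Longrightarrow> Suc i < D \<Longrightarrow> [w (Suc i) + a = w i] (mod m)"
    and inj: "inj_on w {0<..<D}"
  shows "a = 1"
proof (rule ccontr)
  assume "a \<noteq> 1"
  have "w ` {0<..<D} = {0<..<D}"
    by (rule endo_inj_surj) (use w inj in auto)
  then have "a \<in> w ` {0<..<D}" "a - 1 \<in> w ` {0<..<D}"
    using a \<open>a \<noteq> 1\<close> by auto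
  then obtain i j where i: "0 < i" "i < D" "w i = a" and j: "0 < j" "j < D" "w j = a - 1"
    by auto
  have "i \<noteq> j" using i j a by auto
  then consider "Suc i < D" | "Suc j < D" using i j by linarith
  then show False
  proof cases
    case 1
    then have "[w (Suc i) = 0] (mod m)"
      using step[of i] i cong_add_rcancel_nat[of "w (Suc i)" a 0 m] by simp
    then show False using w[of "Suc i"] 1 D by (auto simp: cong_def)
  next
    case 2
    have "[w (Suc j) + 1 + (a - 1) = 0 + (a - 1)] (mod m)"
      using step[of j] j a 2 by (simp add: add.assoc)
    then have "[w (Suc j) + 1 = 0] (mod m)" by (simp only: cong_add_rcancel_nat)
    then show False using w[of "Suc j"] 2 D by (auto simp: cong_def)
  qed
qed

section \<open>The stabilizer of infinity\<close>

lemma translation_simps [simp]: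
  "translation a None = None" "translation a (Some z) = Some (z + a)"
  by (simp_all add: translation_def)

lemma dilation_simps [simp]:
  "dilation a None = None" "dilation a (Some z) = Some (a * z)"
  by (simp_all add: dilation_def)

lemma translation_translation [simp]: "translation a (translation b z) = translation (a + b) z"
  by (cases z) (auto simp: add_ac)

lemma translation_0 [simp]: "translation 0 z = z"
  by (cases z) auto

lemma dilation_dilation [simp]: "dilation a (dilation b z) = dilation (a * b) z"
  by (cases z) auto

lemma dilation_1 [simp]: "dilation 1 z = z"
  by (cases z) auto

lemma dilation_translation: "dilation a (translation b z) = translation (a * b) (dilation a z)"
  by (cases z) (auto simp: algebra_simps)

text \<open>
  The hypotheses of the theorem in terms of composition of functions, with \<open>p = 2 m + 1\<close>. The order
  is \<open>(p\<^sup>3 - p) / 2 = (p + 1) p m\<close>.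
\<close>

locale zp_perm_group =
  fixes G :: "('p::prime_card zp_inf \<Rightarrow> 'p zp_inf) set" and m :: nat
  assumes card: "CARD('p) = 2 * m + 1" and m_pos: "0 < m"
    and bij: "g \<in> G \<Longrightarrow> bij g"
    and comp: "g \<in> G \<Longrightarrow> h \<in> G \<Longrightarrow> g \<circ> h \<in> G"
    and inv_in: "g \<in> G \<Longrightarrow> inv_into UNIV g \<in> G"
    and transitive: "\<exists>g\<in>G. g x = y"
    and card_G: "card G = (2 * m + 2) * ((2 * m + 1) * m)"
    and translation_in: "translation a \<in> G"
begin

lemma finite_G: "finite G"
  by (rule finite_subset[OF subset_UNIV]) simp

lemma card_stabilizer: "card {g \<in> G. g None = None} = (2 * m + 1) * m"
proof -
  let ?H = "{g \<in> G. g None = None}" and ?F = "\<lambda>y. {g \<in> G. g None = y}"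
  have eq: "card (?F y) = card ?H" for y
  proof -
    obtain r where r: "r \<in> G" "r None = y" using transitive by blast
    have "bij_betw (\<lambda>h. r \<circ> h) ?H (?F y)"
    proof (rule bij_betw_byWitness[where f' = "\<lambda>g. inv_into UNIV r \<circ> g"])
      show "\<forall>h\<in>?H. inv_into UNIV r \<circ> (r \<circ> h) = h" "\<forall>g\<in>?F y. r \<circ> (inv_into UNIV r \<circ> g) = g"
        using bij[OF r(1)] by (auto simp: fun_eq_iff bij_is_inj surj_f_inv_f bij_is_surj)
      show "(\<lambda>h. r \<circ> h) ` ?H \<subseteq> ?F y" using r comp by auto
      show "(\<lambda>g. inv_into UNIV r \<circ> g) ` ?F y \<subseteq> ?H"
        using r comp inv_in bij[OF r(1)] by (auto simp: bij_is_inj inv_f_eq)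
    qed
    from bij_betw_same_card[OF this] show ?thesis by (rule sym)
  qed
  have "card G = (\<Sum>y\<in>UNIV. card (?F y))"
  proof -
    have "G = (\<Union>y\<in>UNIV. ?F y)" by auto
    then have "card G = card (\<Union>y\<in>UNIV. ?F y)" by (rule arg_cong)
    also have "\<dots> = (\<Sum>y\<in>UNIV. card (?F y))"
      by (rule card_UN_disjoint) auto
    finally show ?thesis .
  qed
  also have "\<dots> = (\<Sum>y\<in>(UNIV :: 'p zp_inf set). card ?H)" by (rule sum.cong[OF refl eq])
  finally have "(2 * m + 2) * card ?H = (2 * m + 2) * ((2 * m + 1) * m)"
    using card card_G by (simp add: card_UNIV_option)
  then show ?thesis by (simp only: mult_cancel1) simp
qed

text \<open>
  Since \<open>p\<^sup>2 > p m\<close>, two of the \<open>p\<^sup>2\<close> maps \<open>translation x \<circ> h \<circ> translation y\<close> in the stabilizer of \<open>\<infinity>\<close>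
  coincide. This says that \<open>h\<close> intertwines a nonzero shift with a shift, and as \<open>p\<close> is prime, every
  element of \<open>\<int>/p\<close> is a multiple of that nonzero shift.
\<close>

lemma affine:
  assumes h: "h \<in> G" "h None = None"
  obtains a b where "a \<noteq> 0" "h = translation b \<circ> dilation a"
proof -
  let ?H = "{g \<in> G. g None = None}"
  define f where "f = (\<lambda>(x, y). translation x \<circ> h \<circ> translation y)"
  have "\<not> inj_on f (UNIV \<times> UNIV)"
  proof
    assume "inj_on f (UNIV \<times> UNIV)"
    moreover have "f ` (UNIV \<times> UNIV) \<subseteq> ?H"
      using h comp translation_in by (auto simp: f_def)
    ultimately have "card (UNIV \<times> UNIV :: ('p mod_ring \<times> 'p mod_ring) set) \<le> card ?H"
      using finite_G by (intro card_inj_on_le) auto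
    then show False using card m_pos by (simp only: card_stabilizer card_cartesian_product CARD_mod_ring mult_le_cancel1) simp
  qed
  then obtain x y x' y' where ne: "(x, y) \<noteq> (x', y')" and eq: "f (x, y) = f (x', y')"
    by (auto simp: inj_on_def)
  define \<alpha> \<beta> where "\<alpha> = x' - x" and "\<beta> = y - y'"
  define h' where "h' z = the (h (Some z))" for z
  have inj_h: "h u = h v \<longleftrightarrow> u = v" for u v
    using bij_is_inj[OF bij[OF h(1)]] by (rule inj_eq)
  have h': "h (Some z) = Some (h' z)" for z
    using inj_h[of "Some z" None] h(2) by (auto simp: h'_def)
  have inj: "z = z'" if "h' z = h' z'" for z z'
    using inj_h[of "Some z" "Some z'"] that by (simp add: h')
  have shift: "h' (z + y) + x = h' (z + y') + x'" for z
    using fun_cong[OF eq, of "Some z"] h' by (simp add: f_def)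
  have step: "h' (z + \<beta>) = h' z + \<alpha>" for z
    using shift[of "z - y'"] by (simp add: \<alpha>_def \<beta>_def algebra_simps)
  have "\<beta> \<noteq> 0" using step[of 0] ne by (auto simp: \<alpha>_def \<beta>_def)
  have mult: "h' (of_nat n * \<beta>) = h' 0 + of_nat n * \<alpha>" for n
  proof (induction n)
    case (Suc n)
    have "h' (of_nat (Suc n) * \<beta>) = h' (of_nat n * \<beta> + \<beta>)" by (simp add: algebra_simps)
    also have "\<dots> = h' 0 + of_nat (Suc n) * \<alpha>" unfolding step Suc by (simp add: algebra_simps)
    finally show ?case .
  qed simp
  then have lin: "h' z = h' 0 + \<alpha> / \<beta> * z" for z
  proof -
    obtain n where "z / \<beta> = of_nat n" using surj_of_nat_mod_ring by blast
    then have "z = of_nat n * \<beta>" using \<open>\<beta> \<noteq> 0\<close> by (simp add: field_simps)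
    then show ?thesis using mult[of n] \<open>\<beta> \<noteq> 0\<close> by simp
  qed
  have "\<alpha> \<noteq> 0" using step[of 0] \<open>\<beta> \<noteq> 0\<close> inj[of \<beta> 0] by auto
  have "h z = (translation (h' 0) \<circ> dilation (\<alpha> / \<beta>)) z" for z
  proof (cases z)
    case (Some y)
    then show ?thesis using lin[of y] by (simp add: h' add.commute)
  qed (use h in simp)
  then have "h = translation (h' 0) \<circ> dilation (\<alpha> / \<beta>)" by (rule ext)
  then show thesis using that[of "\<alpha> / \<beta>" "h' 0"] \<open>\<alpha> \<noteq> 0\<close> \<open>\<beta> \<noteq> 0\<close> by auto
qed

text \<open>
  The stabilizer of \<open>\<infinity>\<close> is in bijection with pairs of a dilation factor and a shift, so exactly \<open>m\<close>
  factors occur. They form a group of order \<open>m\<close>, hence satisfy \<open>a ^ m = 1\<close>, an equation with only \<open>m\<close>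
  solutions.
\<close>

lemma dilation_in_iff:
  assumes "a \<noteq> 0"
  shows "dilation a \<in> G \<longleftrightarrow> a ^ m = 1"
proof -
  define K where "K = {a. a \<noteq> 0 \<and> dilation a \<in> G}"
  let ?H = "{g \<in> G. g None = None}"
  have dil: "dilation a \<in> G" if "translation b \<circ> dilation a \<in> G" for a b :: "'p mod_ring"
  proof -
    have "translation (- b) \<circ> (translation b \<circ> dilation a) = dilation a" by (auto simp: fun_eq_iff)
    then show ?thesis using comp[OF translation_in that, of "- b"] by simp
  qed
  have "bij_betw (\<lambda>(a, b). translation b \<circ> dilation a) (K \<times> UNIV) ?H"
  proof (rule bij_betwI')
    fix u v :: "'p mod_ring \<times> 'p mod_ring" assume uv: "u \<in> K \<times> UNIV" "v \<in> K \<times> UNIV"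
    obtain a b a' b' where ab: "u = (a, b)" "v = (a', b')" by fastforce
    have "u = v" if "translation b \<circ> dilation a = translation b' \<circ> dilation a'"
      using fun_cong[OF that, of "Some 0"] fun_cong[OF that, of "Some 1"] ab by auto
    then show "((case u of (a, b) \<Rightarrow> translation b \<circ> dilation a) =
        (case v of (a, b) \<Rightarrow> translation b \<circ> dilation a)) = (u = v)"
      using ab by auto
  next
    fix h assume "h \<in> ?H"
    then obtain a b where "a \<noteq> 0" "h = translation b \<circ> dilation a" using affine by blast
    then show "\<exists>x\<in>K \<times> UNIV. h = (case x of (a, b) \<Rightarrow> translation b \<circ> dilation a)"
      using dil \<open>h \<in> ?H\<close> by (intro bexI[of _ "(a, b)"]) (auto simp: K_def)
  qed (auto simp: K_def comp translation_in)
  from bij_betw_same_card[OF this] have "card K * (2 * m + 1) = m * (2 * m + 1)"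
    using card by (simp add: card_stabilizer card_cartesian_product mult.commute)
  then have cK: "card K = m" by (simp only: mult_cancel2) simp
  have "K \<subseteq> {a. a ^ m = 1}"
  proof
    fix a assume a: "a \<in> K"
    have Kmult: "a * b \<in> K" if "b \<in> K" for b
    proof -
      have "dilation a \<circ> dilation b = dilation (a * b)" by (rule ext) simp
      then show ?thesis using comp[of "dilation a" "dilation b"] a that by (auto simp: K_def)
    qed
    have "inj_on ((*) a) K" using a by (auto simp: K_def inj_on_def)
    moreover have "(*) a ` K = K"
      by (rule endo_inj_surj) (use Kmult calculation in auto)
    ultimately have "prod (\<lambda>x. x) K = prod (\<lambda>x. a * x) K"
      using prod.reindex_cong[of "(*) a" K K "\<lambda>x. x" "\<lambda>x. a * x"] by simp
    also have "\<dots> = a ^ m * prod (\<lambda>x. x) K" by (simp add: prod.distrib cK)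
    finally have "1 * prod (\<lambda>x. x) K = a ^ m * prod (\<lambda>x. x) K" unfolding mult_1_left .
    moreover have "prod (\<lambda>x. x) K \<noteq> 0" by (simp add: K_def)
    ultimately have "1 = a ^ m" by (simp only: mult_cancel_right) simp
    then show "a \<in> {a. a ^ m = 1}" by simp
  qed
  then have "K = {a. a ^ m = 1}"
    using cK card_residues(1)[OF card m_pos] by (intro card_subset_eq) auto
  then show ?thesis using assms by (auto simp: K_def)
qed

lemma residue_nonzero: "a ^ m = 1 \<Longrightarrow> a \<noteq> (0 :: 'p mod_ring)"
  using m_pos by (auto simp: power_0_left)

lemma dilation_in: "a ^ m = 1 \<Longrightarrow> dilation a \<in> G"
  using dilation_in_iff residue_nonzero by blast

lemma stabilizer_2:
  assumes "h \<in> G" "h None = None" "h (Some 0) = Some 0"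
  obtains a where "a ^ m = 1" "h = dilation a"
proof -
  obtain a b where ab: "a \<noteq> 0" "h = translation b \<circ> dilation a"
    using affine[OF assms(1,2)] by blast
  then have "h = dilation a" using assms(3) by (auto simp: fun_eq_iff)
  then show thesis using that ab assms(1) dilation_in_iff by blast
qed

lemma ex_swap: "\<exists>t\<in>G. t None = Some 0 \<and> t (Some 0) = None"
proof -
  obtain g where g: "g \<in> G" "g None = Some 0" using transitive by blast
  obtain y where y: "g y = None" using bij_is_surj[OF bij[OF g(1)]] by (metis surjD)
  then obtain z where z: "y = Some z" using g by (cases y) auto
  have "(g \<circ> translation z) None = Some 0 \<and> (g \<circ> translation z) (Some 0) = None"
    using g y z by auto
  then show ?thesis using comp[OF g(1) translation_in] by blast
qed

end

section \<open>An element interchanging 0 and infinity\<close>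

locale swapping = zp_perm_group G m
  for G :: "('p::prime_card zp_inf \<Rightarrow> 'p zp_inf) set" and m :: nat +
  fixes t :: "'p zp_inf \<Rightarrow> 'p zp_inf"
  assumes t_in: "t \<in> G" and t_None [simp]: "t None = Some 0" and t_0 [simp]: "t (Some 0) = None"
begin

text \<open>
  The action of \<open>t\<close> on the nonzero elements. The value \<open>T 0 = 0\<close>, which is not the action of \<open>t\<close>, makes
  \<open>T\<close> a permutation of \<open>\<int>/p\<close>.
\<close>

definition T :: "'p mod_ring \<Rightarrow> 'p mod_ring" where
  "T x = (if x = 0 then 0 else the (t (Some x)))"

lemma inj_t: "t x = t y \<longleftrightarrow> x = y"
  using bij_is_inj[OF bij[OF t_in]] by (rule inj_eq)

lemma t_Some [simp]: "x \<noteq> 0 \<Longrightarrow> t (Some x) = Some (T x)"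
  using inj_t[of "Some x" "Some 0"] by (auto simp: T_def)

lemma T_eq_0_iff [simp]: "T x = 0 \<longleftrightarrow> x = 0"
proof (cases "x = 0")
  case False
  then show ?thesis using inj_t[of "Some x" None] by simp
qed (simp add: T_def)

lemma T_inj: "T x = T y \<longleftrightarrow> x = y"
proof (cases "x = 0 \<or> y = 0")
  case False
  then show ?thesis using inj_t[of "Some x" "Some y"] by auto
next
  case True
  then show ?thesis using T_eq_0_iff[of x] T_eq_0_iff[of y] by metis
qed

lemma T_surj: "\<exists>y. T y = x"
proof -
  have "surj T" by (intro finite_UNIV_inj_surj injI) (simp_all add: T_inj)
  from surjD[OF this, of x] show ?thesis by auto
qed

text \<open>
  For \<open>b \<noteq> 0\<close>, the pole of \<open>t \<circ> translation b \<circ> t\<close>, that is, the point which it sends to \<open>\<infinity>\<close>.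
\<close>

definition c :: "'p mod_ring \<Rightarrow> 'p mod_ring" where
  "c x = (SOME y. T y = - x)"

lemma T_c [simp]: "T (c x) = - x"
  using someI_ex[OF T_surj[of "- x"]] by (simp only: c_def)

lemma c_T: "c (- T y) = y"
proof -
  have "T (c (- T y)) = T y" by (simp only: T_c minus_minus)
  then show ?thesis by (simp only: T_inj)
qed

lemma c_eq_0_iff [simp]: "c x = 0 \<longleftrightarrow> x = 0"
proof -
  have "c x = 0 \<longleftrightarrow> T (c x) = 0" by (simp only: T_eq_0_iff)
  then show ?thesis by (simp only: T_c neg_equal_0_iff_equal)
qed

text \<open>
  Conjugation by \<open>t\<close> maps the dilation by a residue \<open>s\<close> to the dilation by \<open>\<sigma> s\<close>.
\<close>

definition \<sigma> :: "'p mod_ring \<Rightarrow> 'p mod_ring" where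
  "\<sigma> s = T s / T 1"

lemma t_dilation:
  assumes "s ^ m = 1"
  shows "\<sigma> s ^ m = 1" and "t (dilation s z) = dilation (\<sigma> s) (t z)"
proof -
  let ?h = "t \<circ> dilation s \<circ> inv_into UNIV t"
  have inv: "inv_into UNIV t (t z) = z" for z using bij[OF t_in] by (simp add: bij_is_inj)
  have "?h \<in> G" by (intro comp t_in dilation_in[OF assms] inv_in)
  moreover have "?h None = None" "?h (Some 0) = Some 0"
    using inv[of "Some 0"] inv[of None] by auto
  ultimately obtain a where a: "a ^ m = 1" "?h = dilation a" by (rule stabilizer_2)
  have *: "t (dilation s z) = dilation a (t z)" for z
    using fun_cong[OF a(2), of "t z"] inv by simp
  have "T s = a * T 1" using *[of "Some 1"] residue_nonzero[OF assms] by simp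
  moreover have "T 1 \<noteq> 0" by simp
  ultimately have \<sigma>: "\<sigma> s = a" unfolding \<sigma>_def by simp
  show "\<sigma> s ^ m = 1" unfolding \<sigma> by (rule a(1))
  show "t (dilation s z) = dilation (\<sigma> s) (t z)" unfolding \<sigma> by (rule *)
qed

lemma T_mult:
  assumes "s ^ m = 1"
  shows "T (s * x) = \<sigma> s * T x"
  using t_dilation(2)[OF assms, of "Some x"] residue_nonzero[OF assms] by (cases "x = 0") auto

text \<open>
  The map \<open>t\<close> need not be an involution, but its square fixes \<open>0\<close> and \<open>\<infinity>\<close>.
\<close>

lemma t_t: obtains \<kappa> where "\<kappa> ^ m = 1" "\<And>z. t (t z) = dilation \<kappa> z"
proof -
  have "t \<circ> t \<in> G" by (intro comp t_in)
  moreover have "(t \<circ> t) None = None" "(t \<circ> t) (Some 0) = Some 0" by auto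
  ultimately obtain a where a: "a ^ m = 1" "t \<circ> t = dilation a" by (rule stabilizer_2)
  show thesis by (rule that[OF a(1)]) (use fun_cong[OF a(2)] in simp)
qed

lemma \<sigma>_mult:
  assumes "a ^ m = 1" "b ^ m = 1"
  shows "\<sigma> (a * b) = \<sigma> a * \<sigma> b"
  using T_mult[OF assms(1), of b] by (simp add: \<sigma>_def)

lemma \<sigma>_1 [simp]: "\<sigma> 1 = 1"
  by (simp add: \<sigma>_def)

text \<open>
  The dilation \<open>t \<circ> t\<close> commutes with all dilations, so conjugating twice by \<open>t\<close> changes none of them.
\<close>

lemma \<sigma>_\<sigma>:
  assumes "s ^ m = 1"
  shows "\<sigma> (\<sigma> s) = s"
proof -
  obtain \<kappa> where k: "\<kappa> ^ m = 1" "\<And>z. t (t z) = dilation \<kappa> z" using t_t by blast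
  have "T (T x) = \<kappa> * x" if "x \<noteq> 0" for x using k(2)[of "Some x"] that by simp
  from this[of s] this[of 1] have "T (\<sigma> s * T 1) = \<kappa> * s" "T (T 1) = \<kappa>"
    using residue_nonzero[OF assms] by (auto simp: \<sigma>_def)
  then show ?thesis
    using T_mult[OF t_dilation(1)[OF assms], of "T 1"] residue_nonzero[OF k(1)] by simp
qed

text \<open>
  For \<open>b \<noteq> 0\<close> the map \<open>t \<circ> translation b \<circ> t\<close> lies in the double coset of \<open>t\<close>: after translations have
  moved its pole and its value at \<open>\<infinity>\<close> to \<open>0\<close>, it differs from \<open>t\<close> by an element of \<open>G\<close> that fixes \<open>0\<close> and \<open>\<infinity>\<close>.
\<close>

lemma ex_multiplier:
  assumes "b \<noteq> 0"
  shows "\<exists>k. k ^ m = 1 \<and> (\<forall>z. t (translation b (t z)) = translation (T b) (dilation k (t (translation (- c b) z))))"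
proof -
  let ?h = "translation (- T b) \<circ> t \<circ> translation b \<circ> t \<circ> translation (c b) \<circ> inv_into UNIV t"
  have inv: "inv_into UNIV t (t z) = z" for z using bij[OF t_in] by (simp add: bij_is_inj)
  have "?h \<in> G" by (intro comp t_in translation_in inv_in)
  moreover have "?h None = None" "?h (Some 0) = Some 0"
    using inv[of "Some 0"] inv[of None] assms by auto
  ultimately obtain k where k: "k ^ m = 1" "?h = dilation k" by (rule stabilizer_2)
  have "translation (- T b) (t (translation b (t (translation (c b) z)))) = dilation k (t z)" for z
    using fun_cong[OF k(2), of "t z"] inv by simp
  then have "t (translation b (t (translation (c b) z))) = translation (T b) (dilation k (t z))" for z
    by (metis (no_types, lifting) add.right_inverse translation_0 translation_translation)
  from this[of "translation (- c b) _"] show ?thesis using k(1) by auto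
qed

definition k :: "'p mod_ring \<Rightarrow> 'p mod_ring" where
  "k b = (SOME k. k ^ m = 1 \<and> (\<forall>z. t (translation b (t z)) = translation (T b) (dilation k (t (translation (- c b) z)))))"

lemma k_power: "b \<noteq> 0 \<Longrightarrow> k b ^ m = 1"
  and bruhat: "b \<noteq> 0 \<Longrightarrow> t (translation b (t z)) = translation (T b) (dilation (k b) (t (translation (- c b) z)))"
  using someI_ex[OF ex_multiplier[of b]] unfolding k_def by blast+

lemma k_nonzero: "b \<noteq> 0 \<Longrightarrow> k b \<noteq> 0"
  using k_power residue_nonzero by blast

lemma k_eq: "b \<noteq> 0 \<Longrightarrow> k b = - T b / T (- c b)"
  using bruhat[of b "Some 0"] by (simp add: field_simps eq_neg_iff_add_eq_0)

lemma T_bruhat: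
  assumes "b \<noteq> 0" "x \<noteq> 0" "x \<noteq> c b"
  shows "T (T x + b) = T b + k b * T (x - c b)"
proof -
  have "T x \<noteq> T (c b)" using assms by (simp only: T_inj) simp
  then have "T x + b \<noteq> 0" by (simp add: add_eq_0_iff2)
  then show ?thesis using bruhat[of b "Some x"] assms by (simp add: add.commute)
qed

lemma normal_form_unique:
  assumes eq: "\<And>z. translation u (dilation a (t (translation v z))) = translation u' (dilation a' (t (translation v' z)))"
  shows "u = u'" and "a = a'" and "v = v'"
proof -
  show u: "u = u'" using eq[of None] by simp
  show v: "v = v'"
    using eq[of "Some (- v)"] by (cases "- v + v' = 0") (auto simp: add_eq_0_iff2)
  show "a = a'" using eq[of "Some (1 - v)"] u v by simp
qed

text \<open>
  Both sides come from computing \<open>t \<circ> translation b \<circ> t \<circ> translation x \<circ> t\<close> with \<open>bruhat\<close>, once starting from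
  the left and once from the right; the normal form of the result is unique.
\<close>

lemma cocycle:
  assumes "b \<noteq> 0" "x \<noteq> 0" "c b \<noteq> x"
  defines "b' \<equiv> (b + T x) / k x"
  shows "b' \<noteq> 0" and "k b * k (x - c b) = \<sigma> (k x) * k b'" and "c (x - c b) = c b' + c x"
proof -
  have "b \<noteq> - T x" using assms(3) c_T by auto
  then show b': "b' \<noteq> 0" using k_nonzero assms by (auto simp: b'_def add_eq_0_iff2)
  have left: "t (translation b (t (translation x (t z)))) =
     translation (T b + k b * T (x - c b)) (dilation (k b * k (x - c b)) (t (translation (- c (x - c b)) z)))" for z
  proof -
    have "t (translation b (t (translation x (t z)))) =
        translation (T b) (dilation (k b) (t (translation (x - c b) (t z))))"
      using bruhat[OF assms(1), of "translation x (t z)"] by (simp add: add.commute)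
    also have "t (translation (x - c b) (t z)) =
        translation (T (x - c b)) (dilation (k (x - c b)) (t (translation (- c (x - c b)) z)))"
      using assms(3) by (intro bruhat) simp
    finally show ?thesis by (simp add: dilation_translation)
  qed
  have right: "t (translation b (t (translation x (t z)))) =
     translation (\<sigma> (k x) * T b') (dilation (\<sigma> (k x) * k b') (t (translation (- c b' - c x) z)))" for z
  proof -
    let ?y = "t (translation (- c x) z)"
    have "translation b (t (translation x (t z))) = dilation (k x) (translation b' ?y)"
      using k_nonzero[OF assms(2)]
      by (simp add: bruhat[OF assms(2), of z] dilation_translation b'_def)
    then have "t (translation b (t (translation x (t z)))) = dilation (\<sigma> (k x)) (t (translation b' ?y))"
      by (simp only: t_dilation(2)[OF k_power[OF assms(2)]])
    also have "t (translation b' ?y) = translation (T b') (dilation (k b') (t (translation (- c b' - c x) z)))"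
      by (simp add: bruhat[OF b'])
    finally show ?thesis by (simp add: dilation_translation)
  qed
  note nf = normal_form_unique[OF trans[OF left[symmetric] right]]
  show "k b * k (x - c b) = \<sigma> (k x) * k b'" by (rule nf)
  show "c (x - c b) = c b' + c x" using nf(3) by (simp add: algebra_simps)
qed

text \<open>
  The same computation for \<open>b = 0\<close>, where \<open>t \<circ> t\<close> replaces the double coset relation on the left.
\<close>

lemma cocycle_0:
  assumes "x \<noteq> 0" and \<kappa>: "\<And>z. t (t z) = dilation \<kappa> z"
  defines "b' \<equiv> T x / k x"
  shows "\<kappa> = \<sigma> (k x) * k b'" and "c b' = - c x"
proof -
  have b': "b' \<noteq> 0" using k_nonzero assms by (auto simp: b'_def)
  have left: "t (t (translation x (t z))) = translation (\<kappa> * x) (dilation \<kappa> (t (translation 0 z)))" for z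
    by (simp add: \<kappa> dilation_translation)
  have right: "t (t (translation x (t z))) =
     translation (\<sigma> (k x) * T b') (dilation (\<sigma> (k x) * k b') (t (translation (- c b' - c x) z)))" for z
  proof -
    let ?y = "t (translation (- c x) z)"
    have "t (translation x (t z)) = dilation (k x) (translation b' ?y)"
      using k_nonzero[OF assms(1)]
      by (simp add: bruhat[OF assms(1), of z] dilation_translation b'_def)
    then have "t (t (translation x (t z))) = dilation (\<sigma> (k x)) (t (translation b' ?y))"
      by (simp only: t_dilation(2)[OF k_power[OF assms(1)]])
    also have "t (translation b' ?y) = translation (T b') (dilation (k b') (t (translation (- c b' - c x) z)))"
      by (simp add: bruhat[OF b'])
    finally show ?thesis by (simp add: dilation_translation)
  qed
  note nf = normal_form_unique[OF trans[OF left[symmetric] right]]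
  show "\<kappa> = \<sigma> (k x) * k b'" by (rule nf)
  show "c b' = - c x" using nf(3) by (simp add: algebra_simps)
qed

lemma c_mult:
  assumes "s ^ m = 1"
  shows "c (\<sigma> s * x) = s * c x" and "c (s * x) = \<sigma> s * c x"
proof -
  have *: "c (\<sigma> s * x) = s * c x" if "s ^ m = 1" for s
  proof -
    have "T (s * c x) = T (c (\<sigma> s * x))" by (simp add: T_mult[OF that])
    then show ?thesis by (simp only: T_inj)
  qed
  show "c (\<sigma> s * x) = s * c x" using * assms by blast
  show "c (s * x) = \<sigma> s * c x" using *[OF t_dilation(1)[OF assms]] by (simp add: \<sigma>_\<sigma>[OF assms])
qed

lemma k_mult:
  assumes s: "s ^ m = 1" and b: "b \<noteq> 0"
  shows "k (s * b) * s = \<sigma> s * k b"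
proof -
  have s0: "s \<noteq> 0" using s residue_nonzero by blast
  have "k (s * b) = - T (s * b) / T (- c (s * b))" using k_eq[of "s * b"] s0 b by simp
  also have "- c (s * b) = \<sigma> s * (- c b)" by (simp add: c_mult(2)[OF s])
  also have "T \<dots> = s * T (- c b)" using T_mult[OF t_dilation(1)[OF s], of "- c b"] \<sigma>_\<sigma>[OF s] by simp
  finally show ?thesis using k_eq[OF b] s0 by (simp add: T_mult[OF s])
qed

end

section \<open>The intertwining convolution\<close>

lemma power_cong_exponent:
  fixes s :: "'a::monoid_mult"
  assumes "s ^ m = 1" "[u = v] (mod m)"
  shows "s ^ u = s ^ v"
proof -
  have *: "s ^ u = s ^ (u mod m)" for u
  proof -
    have "s ^ u = (s ^ m) ^ (u div m) * s ^ (u mod m)"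
      unfolding power_mult[symmetric] power_add[symmetric] by simp
    then show ?thesis using assms(1) by simp
  qed
  show ?thesis using *[of u] *[of v] assms(2) by (simp add: cong_def)
qed

context swapping
begin

text \<open>
  The kernel of convolution with \<open>q\<close> is stable under \<open>t\<close>. The function \<open>f\<close> is the image under \<open>t\<close> of the
  monomial \<open>z ^ i\<close>, which \<open>q\<close> annihilates by \<open>vanish\<close>. The right-hand side is the contribution of the
  value of this image at \<open>\<infinity>\<close>; it comes from the summand \<open>b = 0\<close> after the vanishing sum at \<open>- c x\<close>
  is reindexed so that \<open>cocycle\<close> applies to the other summands. It is nonzero only for \<open>i = 0\<close>, by the
  convention \<open>0 ^ 0 = 1\<close>.
\<close>

lemma transported_convolution:
  assumes q: "\<And>y. q y = (if y = 0 then 0 else k (- T y) ^ j)"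
    and f: "\<And>x. f x = (if x = 0 then 0 else k x ^ j * (- c x) ^ i)"
    and vanish: "\<And>z. (\<Sum>y\<in>UNIV. q y * (z - y) ^ i) = 0"
    and \<kappa>: "\<And>z. t (t z) = dilation \<kappa> z"
    and x: "x \<noteq> 0"
  shows "(\<Sum>y\<in>UNIV. q y * f (x - y)) = - (\<kappa> ^ j * 0 ^ i)"
proof -
  define b' where "b' b = (b + T x) / k x" for b
  have kx: "k x \<noteq> 0" by (rule k_nonzero[OF x])
  have cb: "c b \<noteq> x \<longleftrightarrow> b \<noteq> - T x" for b
  proof -
    have "c b = x \<longleftrightarrow> T (c b) = T x" by (simp only: T_inj)
    then show ?thesis unfolding T_c by (metis minus_minus)
  qed
  have "0 = \<sigma> (k x) ^ j * (\<Sum>y\<in>UNIV. q y * (- c x - y) ^ i)" by (simp add: vanish)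
  also have "(\<Sum>y\<in>UNIV. q y * (- c x - y) ^ i) = (\<Sum>y\<in>UNIV - {0}. q y * (- c x - y) ^ i)"
    by (rule sum.mono_neutral_right) (auto simp: q)
  also have "\<dots> = (\<Sum>b\<in>UNIV - {- T x}. k (b' b) ^ j * (- c x - c (b' b)) ^ i)"
  proof (rule sum.reindex_bij_witness[of _ "\<lambda>b. c (b' b)" "\<lambda>y. - T y * k x - T x"])
    fix y :: "'p mod_ring" assume y: "y \<in> UNIV - {0}"
    have *: "b' (- T y * k x - T x) = - T y" using kx by (simp add: b'_def)
    show "c (b' (- T y * k x - T x)) = y" unfolding * by (rule c_T)
    show "- T y * k x - T x \<in> UNIV - {- T x}" using y kx by simp
    show "k (b' (- T y * k x - T x)) ^ j * (- c x - c (b' (- T y * k x - T x))) ^ i = q y * (- c x - y) ^ i"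
      unfolding * using y by (simp add: q c_T)
  next
    fix b :: "'p mod_ring" assume b: "b \<in> UNIV - {- T x}"
    then have "b + T x \<noteq> 0" by (auto simp: add_eq_0_iff2)
    then have "b' b \<noteq> 0" using kx by (simp add: b'_def)
    then show "c (b' b) \<in> UNIV - {0}" by simp
    show "- T (c (b' b)) * k x - T x = b" using kx by (simp add: b'_def)
  qed
  also have "\<sigma> (k x) ^ j * \<dots> = (\<Sum>b\<in>UNIV - {- T x}. (\<sigma> (k x) * k (b' b)) ^ j * (- c x - c (b' b)) ^ i)"
    by (simp add: sum_distrib_left power_mult_distrib mult.assoc)
  also have "\<dots> = (\<sigma> (k x) * k (b' 0)) ^ j * (- c x - c (b' 0)) ^ i +
      (\<Sum>b\<in>UNIV - {- T x} - {0}. (\<sigma> (k x) * k (b' b)) ^ j * (- c x - c (b' b)) ^ i)"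
    using x by (intro sum.remove) auto
  also have "(\<sigma> (k x) * k (b' 0)) ^ j * (- c x - c (b' 0)) ^ i = \<kappa> ^ j * 0 ^ i"
    using cocycle_0[OF x \<kappa>] by (simp add: b'_def)
  also have "(\<Sum>b\<in>UNIV - {- T x} - {0}. (\<sigma> (k x) * k (b' b)) ^ j * (- c x - c (b' b)) ^ i) =
      (\<Sum>b\<in>UNIV - {- T x} - {0}. k b ^ j * f (x - c b))"
  proof (rule sum.cong[OF refl])
    fix b :: "'p mod_ring" assume b: "b \<in> UNIV - {- T x} - {0}"
    then have b0: "b \<noteq> 0" "c b \<noteq> x" using cb by auto
    note co = cocycle[OF b0(1) x b0(2), folded b'_def]
    have "- c x - c (b' b) = - c (x - c b)" using co(3) by simp
    then show "(\<sigma> (k x) * k (b' b)) ^ j * (- c x - c (b' b)) ^ i = k b ^ j * f (x - c b)"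
      using b0 co(2)[symmetric] by (simp add: f power_mult_distrib mult.assoc)
  qed
  also have "\<dots> = (\<Sum>y\<in>UNIV - {0} - {x}. q y * f (x - y))"
  proof (rule sum.reindex_bij_witness[of _ "\<lambda>y. - T y" "\<lambda>b. c b"])
    fix b :: "'p mod_ring" assume b: "b \<in> UNIV - {- T x} - {0}"
    then show "c b \<in> UNIV - {0} - {x}" using cb by auto
    show "- T (c b) = b" by simp
    show "q (c b) * f (x - c b) = k b ^ j * f (x - c b)" using b by (simp add: q)
  next
    fix y :: "'p mod_ring" assume y: "y \<in> UNIV - {0} - {x}"
    show "c (- T y) = y" by (rule c_T)
    show "- T y \<in> UNIV - {- T x} - {0}" using y by (simp add: T_inj)
  qed
  also have "\<dots> = (\<Sum>y\<in>UNIV. q y * f (x - y))"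
    by (rule sum.mono_neutral_left) (auto simp: q f)
  finally show ?thesis by (simp add: eq_neg_iff_add_eq_0 add.commute)
qed

text \<open>
  For \<open>i < D\<close> the function \<open>f i\<close> is the image of \<open>z ^ i\<close> under \<open>t\<close>. It is homogeneous of weight \<open>D + e i\<close>, and by
  \<open>transported_convolution\<close> its convolution with \<open>q\<close> is constant on nonzero elements. Hence it is a
  monomial \<open>a x ^ w i\<close>, with \<open>w 0 = D\<close> and with \<open>w i < D\<close> for \<open>i > 0\<close>. The exponents thus form an
  arithmetic progression modulo \<open>m\<close> inside a short interval, so its step is \<open>-1\<close>. Dividing \<open>f 1\<close> by
  \<open>f 0\<close> gives \<open>- c x\<close> as a monomial of exponent \<open>-1\<close>.
\<close>

lemma eq_reciprocal_of_degree:
  assumes e: "e < m" and \<sigma>: "\<And>s. s ^ m = 1 \<Longrightarrow> \<sigma> s = s ^ e"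
    and D: "2 \<le> D" "D < m" and C1: "C1 \<noteq> 0"
    and q: "\<And>y. (if y = 0 then 0 else k (- T y) ^ j) = C0 * y ^ (m - D) + C1 * y ^ (m - D + m)"
    and k: "\<And>s x. s ^ m = 1 \<Longrightarrow> x \<noteq> 0 \<Longrightarrow> k (s * x) ^ j = s ^ D * k x ^ j"
  shows "\<exists>C. \<forall>x. x \<noteq> 0 \<longrightarrow> T x = C / x"
proof -
  obtain \<kappa> where \<kappa>: "\<kappa> ^ m = 1" "\<And>z. t (t z) = dilation \<kappa> z" using t_t by blast
  define q' where "q' y = C0 * y ^ (m - D) + C1 * y ^ (m - D + m)" for y
  define f where "f i x = (if x = 0 then 0 else k x ^ j * (- c x) ^ i)" for i x
  \<comment> \<open>the representative of \<open>D + e i\<close> modulo \<open>m\<close> in \<open>{1..m}\<close>; it must be positive, as \<open>f i 0 = 0\<close>\<close>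
  define w where "w i = (D + e * i - 1) mod m + 1" for i
  have w_range: "0 < w i" "w i \<le> m" for i
    using m_pos by (simp_all add: w_def Suc_leI)
  have w_cong: "[w i = D + e * i] (mod m)" for i
  proof -
    have "[(D + e * i - 1) mod m + 1 = D + e * i - 1 + 1] (mod m)"
      by (intro cong_add) (simp_all add: cong_def)
    then show ?thesis using D by (simp add: w_def)
  qed
  have w_0: "w 0 = D" using D by (simp add: w_def)
  have mono: "\<exists>a. a \<noteq> 0 \<and> (\<forall>x. f i x = a * x ^ w i) \<and> (i \<noteq> 0 \<longrightarrow> w i < D)" if i: "i < D" for i
  proof -
    have hom: "f i (s * x) = s ^ w i * f i x" if s: "s ^ m = 1" for s x
    proof (cases "x = 0")
      case False
      have "f i (s * x) = s ^ D * (s ^ e) ^ i * f i x"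
      proof -
        have "- c (s * x) = s ^ e * (- c x)" by (simp add: c_mult(2)[OF s] \<sigma>[OF s])
        then have "(- c (s * x)) ^ i = (s ^ e) ^ i * (- c x) ^ i" by (simp only: power_mult_distrib)
        then show ?thesis
          using False residue_nonzero[OF s] by (simp add: f_def k[OF s False])
      qed
      also have "s ^ D * (s ^ e) ^ i = s ^ w i"
        using power_cong_exponent[OF s w_cong[of i]] by (simp add: power_add power_mult)
      finally show ?thesis .
    qed (simp add: f_def)
    obtain a b where ab: "\<And>x. f i x = a * x ^ w i + b * x ^ (w i + m)"
    proof -
      have "f i 0 = 0" by (simp add: f_def)
      from homogeneous_eq_two_monomials[OF card m_pos w_range(1) this hom] show thesis using that by blast
    qed
    have conv: "(\<Sum>y\<in>UNIV. q' y * f i (x - y)) = - (\<kappa> ^ j * 0 ^ i)" if "x \<noteq> 0" for x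
    proof (rule transported_convolution[OF _ _ _ \<kappa>(2) that])
      show "q' y = (if y = 0 then 0 else k (- T y) ^ j)" for y by (simp only: q q'_def)
      show "f i x = (if x = 0 then 0 else k x ^ j * (- c x) ^ i)" for x by (rule f_def)
      show "(\<Sum>y\<in>UNIV. q' y * (z - y) ^ i) = 0" for z
        by (rule sum_convolution_eq_0[OF card _ _ C1 q'_def]) (use D i in auto)
    qed
    have md: "0 < m - D" "m - D < m" "m - (m - D) = D" using D by auto
    have db: "b = 0" "a = 0 \<or> w i < D \<or> (w i = D \<and> - (\<kappa> ^ j * 0 ^ i) \<noteq> 0)"
      using degree_bound_of_convolution[OF card md(1,2) C1 q'_def ab w_range conv] md(3) by auto
    have "f i 1 \<noteq> 0" using k_nonzero[of 1] by (simp add: f_def)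
    then have "a \<noteq> 0" using ab[of 1] db(1) by auto
    moreover have "f i x = a * x ^ w i" for x using ab[of x] db(1) by simp
    moreover have "w i < D" if "i \<noteq> 0" using db(2) \<open>a \<noteq> 0\<close> that by (simp add: power_0_left)
    ultimately show ?thesis by blast
  qed
  have D01: "0 < D" "1 < D" using D by auto
  obtain a0 where a0: "a0 \<noteq> 0" "\<And>x. f 0 x = a0 * x ^ D"
    using mono[OF D01(1)] unfolding w_0 by blast
  obtain a1 where a1: "a1 \<noteq> 0" "\<And>x. f 1 x = a1 * x ^ w 1" "w 1 < D"
    using mono[OF D01(2)] one_neq_zero by blast
  have "D - w 1 = 1"
  proof (rule interval_step_eq_1[OF D])
    show "0 < D - w 1" "D - w 1 < D" using a1(3) w_range[of 1] by auto
    show "0 < w i \<and> w i < D" if "0 < i" "i < D" for i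
      using mono[OF that(2)] that(1) w_range(1)[of i] by blast
    show "[w (Suc i) + (D - w 1) = w i] (mod m)" for i
    proof -
      have "[w (Suc i) + D = (D + e * Suc i) + D] (mod m)" by (intro cong_add w_cong) simp
      also have "(D + e * Suc i) + D = (D + e * i) + (D + e * 1)" by simp
      also have "[\<dots> = w i + w 1] (mod m)" by (intro cong_add cong_sym[OF w_cong])
      finally have "[w (Suc i) + (D - w 1) + w 1 = w i + w 1] (mod m)" using a1(3) by simp
      then show ?thesis by (simp only: cong_add_rcancel_nat)
    qed
    \<comment> \<open>if two exponents agreed, some power \<open>(- c x) ^ n\<close> with \<open>0 < n < m\<close> would be constant, but \<open>c\<close> is
      onto the nonzero elements\<close>
    have ne: "w i \<noteq> w i'" if ii: "0 < i" "i < i'" "i' < D" for i i'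
    proof
      assume eq: "w i = w i'"
      have "i < D" using ii by simp
      obtain a where a: "a \<noteq> 0" "\<And>x. f i x = a * x ^ w i" using mono[OF \<open>i < D\<close>] by blast
      obtain a' where a': "a' \<noteq> 0" "\<And>x. f i' x = a' * x ^ w i'" using mono[OF ii(3)] by blast
      have const: "(- c x) ^ (i' - i) = a' / a" if "x \<noteq> 0" for x
      proof -
        have "f i' x = f i x * (- c x) ^ (i' - i)"
        proof -
          have "(- c x) ^ i' = (- c x) ^ i * (- c x) ^ (i' - i)"
            unfolding power_add[symmetric] using ii by simp
          then show ?thesis using that by (simp only: f_def if_False mult.assoc)
        qed
        then have "a' * x ^ w i = a * x ^ w i * (- c x) ^ (i' - i)" by (simp only: a a' eq)
        then have "a' * x ^ w i = (a * (- c x) ^ (i' - i)) * x ^ w i" by (simp only: mult_ac)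
        then have "a' = a * (- c x) ^ (i' - i)" unfolding mult_cancel_right using that by simp
        then show ?thesis using a(1) by simp
      qed
      have pow: "z ^ (i' - i) = a' / a" if "z \<noteq> 0" for z
      proof -
        have "- T (- z) \<noteq> 0" using that by simp
        from const[OF this] show ?thesis unfolding c_T by simp
      qed
      have "0 < i' - i" "i' - i < CARD('p) - 1" using ii D card by linarith+
      then obtain z :: "'p mod_ring" where "z \<noteq> 0" "z ^ (i' - i) \<noteq> 1"
        using exists_power_neq_1 by blast
      moreover from pow[of 1] have "a' / a = 1" by simp
      ultimately show False using pow[of z] by metis
    qed
    show "inj_on w {0<..<D}"
    proof (rule linorder_inj_onI)
      show "w i \<noteq> w i'" if "i < i'" "i \<in> {0<..<D}" "i' \<in> {0<..<D}" for i i'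
        by (rule ne) (use that in simp_all)
    qed linarith
  qed
  then have "D = Suc (w 1)" using a1(3) by simp
  have c: "c x * x = - (a1 / a0)" if "x \<noteq> 0" for x
  proof -
    have "f 1 x = f 0 x * (- c x)" using that by (simp add: f_def)
    then have "a1 * x ^ w 1 = a0 * x ^ Suc (w 1) * (- c x)" by (simp only: a0 a1 \<open>D = Suc (w 1)\<close>)
    then have "a1 * x ^ w 1 = (- (a0 * (c x * x))) * x ^ w 1" by (simp add: mult_ac)
    then have "a1 = - (a0 * (c x * x))" unfolding mult_cancel_right using that by simp
    moreover have "- (a0 * (c x * x)) / a0 = - (c x * x)" using a0(1) by simp
    ultimately show ?thesis by (simp only: minus_minus)
  qed
  have "T x = (a1 / a0) / x" if "x \<noteq> 0" for x
  proof -
    have "- T x \<noteq> 0" using that by simp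
    from c[OF this] have "x * (- T x) = - (a1 / a0)" unfolding c_T .
    then have "x * T x = a1 / a0" unfolding mult_minus_right neg_equal_iff_equal .
    moreover have "x * T x / x = T x" using that by simp
    ultimately show ?thesis by (simp only:)
  qed
  then show ?thesis by blast
qed

text \<open>
  It remains to find an exponent \<open>j\<close> for which \<open>q\<close> has a suitable degree. Put \<open>r = e - 1\<close>. As the values
  of \<open>k\<close> are residues, the functions for \<open>j = m - 1\<close> and \<open>j = 1\<close> are inverse to each other where they do
  not vanish. The first is \<open>C0 y ^ r + C1 y ^ (r + m)\<close>. If \<open>C1 \<noteq> 0\<close>, it has the required form with
  \<open>D = m - r\<close>. Otherwise it is a multiple of \<open>y ^ r\<close>, and its inverse, a multiple of \<open>y ^ (2 m - r)\<close>, has the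
  required form with \<open>D = r\<close>. The value \<open>r = 1\<close> cannot occur then, since the multiples of \<open>y\<close> are not
  all residues.
\<close>

lemma eq_reciprocal_if_nontrivial:
  assumes "s0 ^ m = 1" "\<sigma> s0 \<noteq> s0"
  shows "\<exists>C. \<forall>x. x \<noteq> 0 \<longrightarrow> T x = C / x"
proof -
  obtain e where e: "e < m" and \<sigma>: "\<And>s. s ^ m = 1 \<Longrightarrow> \<sigma> s = s ^ e"
    using multiplicative_on_residues[OF card m_pos \<sigma>_mult t_dilation(1)] by blast
  have "e \<noteq> 1" using assms \<sigma>[of s0] by auto
  moreover have "e \<noteq> 0"
  proof
    assume "e = 0"
    then have "\<sigma> s0 = 1" using \<sigma>[OF assms(1)] by simp
    then have "s0 = \<sigma> 1" using \<sigma>_\<sigma>[OF assms(1)] by simp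
    then show False using assms by simp
  qed
  ultimately have e2: "2 \<le> e" by simp
  define r where "r = e - 1"
  have r: "0 < r" "r + 1 < m" "e = r + 1" using e e2 by (auto simp: r_def)
  have inverse_power: "(a ^ u) ^ (m - 1) = a ^ (m - u)" if "a ^ m = 1" "u \<le> m" for a :: "'p mod_ring" and u
  proof -
    have "u * (m - 1) + u = u * (m - 1 + 1)" by (simp only: distrib_left mult_1_right)
    then have "u * (m - 1) + u = u * m" using m_pos by simp
    then have "[u * (m - 1) + u = m - u + u] (mod m)" using that by (simp add: cong_def)
    then have "[u * (m - 1) = m - u] (mod m)" by (simp only: cong_add_rcancel_nat)
    then show ?thesis using power_cong_exponent[OF that(1)] by (simp flip: power_mult)
  qed
  define q where "q j y = (if y = 0 then 0 else k (- T y) ^ j)" for j y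
  have k_hom: "k (s * x) = s ^ r * k x" if s: "s ^ m = 1" "x \<noteq> 0" for s x
  proof -
    have "k (s * x) * s = (s ^ r * k x) * s"
      using k_mult[OF s] by (simp add: \<sigma>[OF s(1)] r(3))
    then show ?thesis using residue_nonzero[OF s(1)] by simp
  qed
  have \<sigma>_r: "\<sigma> s ^ r = s ^ (m - r)" if s: "s ^ m = 1" for s
  proof -
    have "\<sigma> s ^ r * \<sigma> s = s"
      using \<sigma>[OF t_dilation(1)[OF s]] by (simp add: \<sigma>_\<sigma>[OF s] r(3) mult.commute)
    also have "s = s ^ (m - r) * \<sigma> s"
    proof -
      have "m - r + e = Suc m" using r by simp
      then have "s ^ (m - r) * s ^ e = s" using s by (simp flip: power_add)
      then show ?thesis by (simp add: \<sigma>[OF s])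
    qed
    finally show ?thesis using residue_nonzero[OF t_dilation(1)[OF s]] by simp
  qed
  have q_hom: "q 1 (s * y) = s ^ (m - r) * q 1 y" if s: "s ^ m = 1" for s y
    using k_hom[OF t_dilation(1)[OF s], of "- T y"] residue_nonzero[OF s]
    by (simp add: q_def T_mult[OF s] \<sigma>_r[OF s])
  have q_pow: "q (m - 1) y = q 1 y ^ (m - 1)" for y
    using r by (simp add: q_def)
  have q_hom': "q (m - 1) (s * y) = s ^ r * q (m - 1) y" if s: "s ^ m = 1" for s y
    unfolding q_pow q_hom[OF s] power_mult_distrib using inverse_power[OF s, of "m - r"] r by simp
  have "q (m - 1) 0 = 0" by (simp add: q_def)
  from homogeneous_eq_two_monomials[OF card m_pos r(1) this q_hom']
  obtain C0 C1 where C: "\<And>y. q (m - 1) y = C0 * y ^ r + C1 * y ^ (r + m)" by blast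
  have mr: "m - (m - r) = r" using r by simp
  show ?thesis
  proof (cases "C1 = 0")
    case False
    show ?thesis
    proof (rule eq_reciprocal_of_degree[OF e \<sigma> _ _ False])
      show "2 \<le> m - r" "m - r < m" using r by auto
      show "(if y = 0 then 0 else k (- T y) ^ (m - 1)) = C0 * y ^ (m - (m - r)) + C1 * y ^ (m - (m - r) + m)" for y
        unfolding mr using C[of y] unfolding q_def .
      show "k (s * x) ^ (m - 1) = s ^ (m - r) * k x ^ (m - 1)" if "s ^ m = 1" "x \<noteq> 0" for s x
        using inverse_power[OF that(1), of r] r by (simp add: k_hom[OF that] power_mult_distrib)
    qed
  next
    case True
    have q_power: "q 1 y ^ m = 1" if "y \<noteq> 0" for y
      using that k_power[of "- T y"] by (simp add: q_def)
    have inv: "q 1 y * (C0 * y ^ r) = 1" if "y \<noteq> 0" for y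
    proof -
      have "q 1 y * (C0 * y ^ r) = q 1 y * q 1 y ^ (m - 1)" 
        using C[of y] unfolding q_pow True by simp
      also have "\<dots> = q 1 y ^ Suc (m - 1)" by (simp only: power_Suc)
      also have "Suc (m - 1) = m" using m_pos by simp
      finally show ?thesis unfolding q_power[OF that] .
    qed
    have "r \<noteq> 1"
    proof
      assume "r = 1"
      have *: "(C0 * y) ^ m = 1" if "y \<noteq> 0" for y
      proof -
        have "(q 1 y * (C0 * y)) ^ m = 1" using inv[OF that] unfolding \<open>r = 1\<close> power_one_right by simp
        then show ?thesis unfolding power_mult_distrib[of "q 1 y"] q_power[OF that] by simp
      qed
      obtain n :: "'p mod_ring" where n: "n ^ m = -1" "n \<noteq> 0" using nonresidue_exists[OF card m_pos] by auto
      have "C0 ^ m = 1" "C0 ^ m * n ^ m = 1" using *[of 1] *[OF n(2)] by (simp_all add: power_mult_distrib)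
      then show False using n(1) one_neq_minus_one(1)[OF card m_pos] by simp
    qed
    have C0: "C0 \<noteq> 0" using inv[of 1] by auto
    show ?thesis
    proof (rule eq_reciprocal_of_degree[OF e \<sigma>])
      show "2 \<le> r" "r < m" using r \<open>r \<noteq> 1\<close> by auto
      show "1 / C0 \<noteq> 0" using C0 by simp
      show "(if y = 0 then 0 else k (- T y) ^ 1) = 0 * y ^ (m - r) + 1 / C0 * y ^ (m - r + m)" for y
      proof (cases "y = 0")
        case False
        have "m - r + m + r = 2 * m" using r by simp
        then have "y ^ (m - r + m) * y ^ r = 1"
          using power_half_cases(2)[OF card False] by (simp only: power_add[symmetric])
        then have "1 / C0 * y ^ (m - r + m) * (C0 * y ^ r) = q 1 y * (C0 * y ^ r)"
          unfolding inv[OF False] using C0 by (simp add: mult_ac)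
        then have "1 / C0 * y ^ (m - r + m) = q 1 y"
          unfolding mult_cancel_right using C0 False by simp
        then show ?thesis unfolding q_def by simp
      qed (use r in \<open>simp add: power_0_left\<close>)
      show "k (s * x) ^ 1 = s ^ r * k x ^ 1" if "s ^ m = 1" "x \<noteq> 0" for s x
        using k_hom[OF that] by simp
    qed
  qed
qed

end

context swapping
begin

section \<open>The case of trivial conjugation\<close>

lemma neg_recip_in:
  assumes T: "\<And>x. x \<noteq> 0 \<Longrightarrow> T x = C / x"
  shows "neg_recip \<in> G"
proof -
  have C: "C \<noteq> 0" using T[of 1] T_eq_0_iff[of 1] by auto
  have "c 1 = - C"
  proof -
    have "T (c 1) = T (- C)" using T[of "- C"] C by simp
    then show ?thesis by (simp only: T_inj)
  qed
  then have "k 1 = - C" using k_eq[of 1] T[of 1] T[of C] C by simp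
  then have "(- C) ^ m = 1" using k_power[of 1] by simp
  then have "(- 1 / C) ^ m = 1"
    by (simp add: power_divide flip: minus_divide_right)
       (metis divide_minus_left divide_self_if minus_divide_right one_neq_zero power_one power_one_over)
  then have "dilation (- 1 / C) \<circ> t \<in> G" by (intro comp dilation_in t_in)
  also have "dilation (- 1 / C) \<circ> t = neg_recip"
  proof
    fix z show "(dilation (- 1 / C) \<circ> t) z = neg_recip z"
    proof (cases z)
      case (Some x)
      then show ?thesis using C T[of x] by (cases "x = 0") (auto simp: neg_recip_def)
    qed (simp add: neg_recip_def)
  qed
  finally show ?thesis .
qed

text \<open>
  Here \<open>T (s x) = s * T x\<close> for residues \<open>s\<close>, so \<open>T\<close> is known from \<open>A = T 1\<close> and \<open>B = - T (-1)\<close> as soon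
  as it is known which elements are residues. The relation for \<open>b = - A\<close> is evaluated at the residues
  \<open>x \<noteq> 1\<close>, of which there are \<open>m - 1\<close>. If \<open>A\<close> is a residue, it determines \<open>T (x - 1)\<close> and thus allows at
  most one \<open>x\<close>; this gives \<open>p = 5\<close>. If \<open>A\<close> and \<open>-A\<close> are both nonresidues, then \<open>k 1 = - A\<close> is a
  contradiction. Otherwise the relation is linear in \<open>u = 1 - x\<close>, with one equation for residues \<open>u\<close> and
  one for nonresidues, so there are at most two such \<open>x\<close>; this gives \<open>p = 3\<close> or \<open>p = 7\<close>.
\<close>

lemma trivial_\<sigma>_cases:
  assumes id: "\<And>s. s ^ m = 1 \<Longrightarrow> \<sigma> s = s"
  shows "(\<exists>C. \<forall>x. x \<noteq> 0 \<longrightarrow> T x = C / x) \<or>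
    m = 3 \<and> T 1 ^ m = -1 \<and> (T 1)\<^sup>2 - T 1 * T (- 1) + (T (- 1))\<^sup>2 = 0"
proof -
  have Ts: "T (s * x) = s * T x" if "s ^ m = 1" for s x
    using T_mult[OF that] id[OF that] by simp
  define A B where "A = T 1" and "B = - T (- 1)"
  have A0: "A \<noteq> 0" and B0: "B \<noteq> 0" by (simp_all add: A_def B_def)
  have TK: "T s = s * A" if "s ^ m = 1" for s using Ts[OF that, of 1] by (simp add: A_def)
  have T_minus: "T (- s) = - (s * B)" if "s ^ m = 1" for s using Ts[OF that, of "-1"] by (simp add: B_def)
  have two: "(2 :: 'p mod_ring) \<noteq> 0" using one_neq_minus_one[OF card m_pos] by simp
  have pm: "(1 :: 'p mod_ring) \<noteq> -1" using one_neq_minus_one[OF card m_pos] by simp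
  let ?K = "{s :: 'p mod_ring. s ^ m = 1}"
  have cardK: "card ?K = m" by (rule card_residues(1)[OF card m_pos])
  have cardK1: "card (?K - {1}) = m - 1" using cardK by (simp add: card_Diff_singleton)
  \<comment> \<open>the choice \<open>b = - A\<close> places the pole \<open>c b\<close> at \<open>1\<close>\<close>
  have c1: "c (- A) = 1" using c_T[of 1] by (simp add: A_def)
  have kA: "k (- A) = T (- A) / B" using k_eq[of "- A"] A0 by (simp add: c1 B_def)
  have rel: "T (T x - A) = T (- A) + k (- A) * T (x - 1)" if "x \<noteq> 0" "x \<noteq> 1" for x
    using T_bruhat[of "- A" x] A0 c1 that by simp
  consider "A ^ m = 1" | "A ^ m = -1" "(-1 :: 'p mod_ring) ^ m = 1" | "A ^ m = -1" "(-1 :: 'p mod_ring) ^ m = -1"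
    using power_half_cases(1)[OF card, of A] power_half_cases(1)[OF card, of "-1"] A0 by auto
  then show ?thesis
  proof cases
    case 1
    have "k (- A) = - A" using B0 by (simp add: kA T_minus[OF 1])
    then have "(- A) ^ m = 1" using k_power[of "- A"] A0 by simp
    then have m1: "(-1 :: 'p mod_ring) ^ m = 1" using 1 by (metis mult_1_right mult_minus1 power_mult_distrib)
    have BA: "B = A" using TK[OF m1] by (simp add: B_def)
    have half: "2 * T (x - 1) = - A" if "x ^ m = 1" "x \<noteq> 1" for x
    proof -
      have "T x - A = A * (x - 1)" by (simp add: TK[OF that(1)] algebra_simps)
      then have "A * T (x - 1) = - (A * A) + (- A) * T (x - 1)"
        using rel[of x] residue_nonzero[OF that(1)] that(2) Ts[OF 1, of "x - 1"]
        by (simp add: T_minus[OF 1] \<open>k (- A) = - A\<close> BA)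
      then have "A * (2 * T (x - 1)) = A * (- A)" by (simp add: algebra_simps)
      then show ?thesis unfolding mult_cancel_left using A0 by simp
    qed
    have "card (?K - {1}) \<le> 1"
    proof (rule card_le_Suc0_iff_eq[THEN iffD2, unfolded One_nat_def[symmetric]])
      show "\<forall>x\<in>?K - {1}. \<forall>y\<in>?K - {1}. x = y"
      proof (intro ballI)
        fix x y assume "x \<in> ?K - {1}" "y \<in> ?K - {1}"
        then have "2 * T (x - 1) = 2 * T (y - 1)" using half by simp
        then have "T (x - 1) = T (y - 1)" using two by simp
        then show "x = y" by (simp add: T_inj)
      qed
    qed simp
    moreover have "m \<noteq> 1" using m1 pm by auto
    ultimately have m: "m = 2" using cardK1 m_pos by simp
    have h: "2 * T (- 2) = - A" using half[of "-1"] m pm by simp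
    have "CARD('p) = 5" using card m by simp
    then have five: "(5 :: 'p mod_ring) = 0"
      using of_nat_card_eq_0[where 'a='p] by simp
    have "T x = A / x" if x: "x \<noteq> 0" for x
      using power_half_cases(1)[OF card x]
    proof
      assume "x ^ m = 1"
      then show ?thesis using TK[of x] m x by (simp add: field_simps power2_eq_square)
    next
      assume xm: "x ^ m = -1"
      have four: "(4 :: 'p mod_ring) = -1" using five by (simp add: eq_neg_iff_add_eq_0)
      have xx: "x * x = -1" using xm by (simp add: m power2_eq_square)
      define s where "s = 2 * x"
      have "s ^ m = 4 * (x * x)" by (simp add: s_def m power2_eq_square)
      then have s: "s ^ m = 1" by (simp add: xx four)
      have "s * (- 2) = - (4 * x)" by (simp add: s_def)
      then have "x = s * (- 2)" by (simp add: four)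
      then have "T x = s * T (- 2)" using Ts[OF s, of "- 2"] by simp
      then have "2 * (x * T x) = (s * x) * (2 * T (- 2))" by simp
      also have "s * x = 2 * (x * x)" by (simp add: s_def)
      also have "\<dots> = -2" by (simp add: xx)
      finally have "2 * (x * T x) = 2 * A" by (simp add: h)
      then have "x * T x = A" unfolding mult_cancel_left using two by simp
      then show ?thesis using x by (simp add: eq_divide_eq mult.commute)
    qed
    then show ?thesis by blast
  next
    case 2
    have "T (- c 1) = 1" using Ts[OF 2(2), of "c 1"] by simp
    then have "k 1 = - A" using k_eq[of 1] by (simp add: A_def)
    then have "(- A) ^ m = 1" using k_power[of 1] by simp
    then have "(-1) ^ m * A ^ m = 1" by (metis mult_minus1 power_mult_distrib)
    then show ?thesis using 2 pm by simp
  next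
    case 3
    have mA: "(- A) ^ m = 1" using 3 power_mult_distrib[of "-1" A m] by simp
    have kA': "k (- A) = - (A * A) / B" by (simp add: kA TK[OF mA])
    have u_eq: "B * T u = A * B + A * T (- u)" if u: "(1 - u) ^ m = 1" "u \<noteq> 0" for u
    proof -
      let ?x = "1 - u"
      have "T ?x - A = (- A) * u" by (simp add: TK[OF u(1)] algebra_simps)
      then have "(- A) * T u = - (A * A) + - (A * A) / B * T (- u)"
        using rel[of ?x] residue_nonzero[OF u(1)] u(2) Ts[OF mA, of u] by (simp add: TK[OF mA] kA')
      then have "(- A) * T u * B = (- (A * A) + - (A * A) / B * T (- u)) * B" by (simp only:)
      then have "(- A) * (B * T u) = (- A) * (A * B + A * T (- u))" using B0 by (simp add: algebra_simps)
      then show ?thesis using A0 by (simp only: mult_cancel_left) simp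
    qed
    have u_cases: "2 * u = 1 \<or> u * (A * A + B * B) = A * B" if u: "(1 - u) ^ m = 1" "u \<noteq> 0" for u
      using power_half_cases(1)[OF card u(2)]
    proof
      assume um: "u ^ m = 1"
      have "A * B * (2 * u) = A * B * 1" using u_eq[OF u] by (simp add: TK[OF um] T_minus[OF um] algebra_simps)
      then show ?thesis using A0 B0 by simp
    next
      assume um: "u ^ m = -1"
      have mu: "(- u) ^ m = 1" using um 3 power_mult_distrib[of "-1" u m] by simp
      have "T u = u * B" using T_minus[OF mu] by simp
      then show ?thesis using u_eq[OF u] TK[OF mu] by (simp add: algebra_simps)
    qed
    have "?K - {1} \<subseteq> {1 - 1 / 2, 1 - A * B / (A * A + B * B)}"
    proof
      fix x assume x: "x \<in> ?K - {1}"
      then have "2 * (1 - x) = 1 \<or> (1 - x) * (A * A + B * B) = A * B" using u_cases[of "1 - x"] by simp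
      moreover have "1 - x = 1 / 2" if "2 * (1 - x) = 1"
        using that two by (simp only: eq_divide_eq mult.commute) simp
      moreover have "1 - x = A * B / (A * A + B * B)" if "(1 - x) * (A * A + B * B) = A * B"
      proof -
        have "A * A + B * B \<noteq> 0" using that A0 B0 by auto
        show ?thesis unfolding nonzero_eq_divide_eq[OF \<open>A * A + B * B \<noteq> 0\<close>] by (rule that)
      qed
      ultimately have "x = 1 - 1 / 2 \<or> x = 1 - A * B / (A * A + B * B)"
        by (metis diff_diff_eq2 add_diff_cancel_left')
      then show "x \<in> {1 - 1 / 2, 1 - A * B / (A * A + B * B)}" by blast
    qed
    then have "card (?K - {1}) \<le> card {1 - 1 / 2, 1 - A * B / (A * A + B * B)}" by (intro card_mono) auto
    also have "\<dots> \<le> 2" by (simp add: card_insert_if)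
    finally have "m \<le> 3" using cardK1 by simp
    moreover have "m \<noteq> 2" using 3(2) pm by auto
    ultimately consider "m = 1" | "m = 3" using m_pos by linarith
    then show ?thesis
    proof cases
      case m: 1
      have A: "A = -1" using 3(1) m by simp
      have pmx: "x = 1 \<or> x = -1" if "x \<noteq> 0" for x :: "'p mod_ring"
        using power_half_cases(1)[OF card that] m by simp
      have "B = -1 \<or> B = 1" using pmx[OF B0] by auto
      moreover have "B \<noteq> 1"
      proof
        assume "B = 1"
        then have "T (- 1) = -1" unfolding B_def by (metis minus_minus)
        also have "-1 = T 1" using A by (simp add: A_def)
        finally have "1 = (-1 :: 'p mod_ring)" by (simp only: T_inj)
        then show False using pm by blast
      qed
      ultimately have B: "B = -1" by simp
      have "T x = -1 / x" if "x \<noteq> 0" for x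
        using pmx[OF that] A B by (auto simp: A_def B_def)
      then show ?thesis by blast
    next
      case m: 2
      have "CARD('p) = 7" using card m by simp
      then have seven: "(7 :: 'p mod_ring) = 0" using of_nat_card_eq_0[where 'a='p] by simp
      have "(2 :: 'p mod_ring) ^ m = 7 + 1" by (simp add: m)
      then have "(2 :: 'p mod_ring) ^ m = 1" by (simp only: seven add_0_left)
      then have "B * T (-1) = A * B + A * T 1" using u_eq[of "-1"] by simp
      then have "A\<^sup>2 + A * B + B\<^sup>2 = 0" by (simp add: A_def B_def power2_eq_square algebra_simps)
      then show ?thesis using m 3(1) by (simp add: A_def B_def)
    qed
  qed
qed

end

section \<open>The exceptional prime 7\<close>

context
  assumes card7: "CARD('p::prime_card) = 7"
begin

lemma of_nat_eq_mod7: "(of_nat a :: 'p mod_ring) = of_nat b \<longleftrightarrow> a mod 7 = b mod 7"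
  by (simp add: of_nat_eq_iff_cong_CHAR cong_def card7)

lemma numeral_eq_mod7:
  "(numeral a :: 'p mod_ring) = numeral b \<longleftrightarrow> (numeral a :: nat) mod 7 = numeral b mod 7"
  "(numeral a :: 'p mod_ring) = 1 \<longleftrightarrow> (numeral a :: nat) mod 7 = 1"
  "(1 :: 'p mod_ring) = numeral a \<longleftrightarrow> (numeral a :: nat) mod 7 = 1"
  "(numeral a :: 'p mod_ring) = 0 \<longleftrightarrow> (numeral a :: nat) mod 7 = 0"
  "(0 :: 'p mod_ring) = numeral a \<longleftrightarrow> (numeral a :: nat) mod 7 = 0"
proof -
  show "(numeral a :: 'p mod_ring) = numeral b \<longleftrightarrow> (numeral a :: nat) mod 7 = numeral b mod 7"
    using of_nat_eq_mod7[of "numeral a" "numeral b"] by simp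
  show one: "(numeral a :: 'p mod_ring) = 1 \<longleftrightarrow> (numeral a :: nat) mod 7 = 1"
    using of_nat_eq_mod7[of "numeral a" 1] by simp
  show zero: "(numeral a :: 'p mod_ring) = 0 \<longleftrightarrow> (numeral a :: nat) mod 7 = 0"
    using of_nat_eq_mod7[of "numeral a" 0] by simp
  show "(1 :: 'p mod_ring) = numeral a \<longleftrightarrow> (numeral a :: nat) mod 7 = 1"
    by (subst eq_commute) (rule one)
  show "(0 :: 'p mod_ring) = numeral a \<longleftrightarrow> (numeral a :: nat) mod 7 = 0"
    by (subst eq_commute) (rule zero)
qed

lemma mod7_cases:
  fixes x :: "'p mod_ring"
  obtains "x = 0" | "x = 1" | "x = 2" | "x = 3" | "x = 4" | "x = 5" | "x = 6"
proof -
  obtain i where i: "i < 7" "x = of_nat i" using surj_of_nat_mod_ring[of x] card7 by auto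
  then have "i = 0 \<or> i = 1 \<or> i = 2 \<or> i = 3 \<or> i = 4 \<or> i = 5 \<or> i = 6" by linarith
  then show thesis using i that by auto
qed

lemma invol1_values:
  "invol1 None = Some (0 :: 'p mod_ring)" "invol1 (Some (0 :: 'p mod_ring)) = None"
  "invol1 (Some (1 :: 'p mod_ring)) = Some 3" "invol1 (Some (2 :: 'p mod_ring)) = Some 6"
  "invol1 (Some (3 :: 'p mod_ring)) = Some 1" "invol1 (Some (4 :: 'p mod_ring)) = Some 5"
  "invol1 (Some (5 :: 'p mod_ring)) = Some 4" "invol1 (Some (6 :: 'p mod_ring)) = Some 2"
  by (simp_all add: invol1_def Transposition.transpose_def numeral_eq_mod7)

lemma invol2_values:
  "invol2 None = Some (0 :: 'p mod_ring)" "invol2 (Some (0 :: 'p mod_ring)) = None"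
  "invol2 (Some (1 :: 'p mod_ring)) = Some 5" "invol2 (Some (2 :: 'p mod_ring)) = Some 3"
  "invol2 (Some (3 :: 'p mod_ring)) = Some 2" "invol2 (Some (4 :: 'p mod_ring)) = Some 6"
  "invol2 (Some (5 :: 'p mod_ring)) = Some 1" "invol2 (Some (6 :: 'p mod_ring)) = Some 4"
  by (simp_all add: invol2_def Transposition.transpose_def numeral_eq_mod7)

lemma eq_if_eq_on_mod7:
  fixes f g :: "'p zp_inf \<Rightarrow> 'p zp_inf"
  assumes "f None = g None" "f (Some 0) = g (Some 0)" "f (Some 1) = g (Some 1)"
    "f (Some 2) = g (Some 2)" "f (Some 3) = g (Some 3)" "f (Some 4) = g (Some 4)"
    "f (Some 5) = g (Some 5)" "f (Some 6) = g (Some 6)"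
  shows "f = g"
proof
  fix z show "f z = g z"
  proof (cases z)
    case (Some x)
    then show ?thesis using assms by (cases x rule: mod7_cases) simp_all
  qed (use assms in simp)
qed

end

context swapping
begin

text \<open>
  With \<open>B = T (-1)\<close>, the quadratic relation factors modulo \<open>7\<close> as \<open>(B - 3 T 1) (B - 5 T 1) = 0\<close>. In either
  case a dilation by a residue normalizes \<open>T 1\<close>, to \<open>3\<close> or to \<open>5\<close>, and turns \<open>t\<close> into one of the two
  involutions.
\<close>

lemma invol_in:
  assumes id: "\<And>s. s ^ m = 1 \<Longrightarrow> \<sigma> s = s" and m: "m = 3"
    and A: "T 1 ^ m = -1" and quad: "(T 1)\<^sup>2 - T 1 * T (- 1) + (T (- 1))\<^sup>2 = 0"
  shows "invol1 \<in> G \<or> invol2 \<in> G"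
proof -
  have card7: "CARD('p) = 7" using card m by simp
  note eq7 = numeral_eq_mod7[OF card7]
  have A0: "T 1 \<noteq> 0" by simp
  have K: "(1 :: 'p mod_ring) ^ m = 1" "(2 :: 'p mod_ring) ^ m = 1" "(4 :: 'p mod_ring) ^ m = 1"
    by (simp_all add: m eq7)
  have Ts: "T (s * x) = s * T x" if "s ^ m = 1" for s x
    using T_mult[OF that] id[OF that] by simp
  have minus: "(6 :: 'p mod_ring) = 1 * (-1)" "(5 :: 'p mod_ring) = 2 * (-1)" "(3 :: 'p mod_ring) = 4 * (-1)"
    by (simp_all add: eq_neg_iff_add_eq_0 eq7)
  define B where "B = T (-1)"
  have T6: "T 6 = B" and T5: "T 5 = 2 * B" and T3: "T 3 = 4 * B"
    unfolding minus B_def Ts[OF K(1)] Ts[OF K(2)] Ts[OF K(3)] by simp_all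
  have T2: "T 2 = 2 * T 1" and T4: "T 4 = 4 * T 1" using Ts[OF K(2), of 1] Ts[OF K(3), of 1] by simp_all
  have nz: "(2 :: 'p mod_ring) \<noteq> 0" "(3 :: 'p mod_ring) \<noteq> 0" "(4 :: 'p mod_ring) \<noteq> 0"
    "(5 :: 'p mod_ring) \<noteq> 0" "(6 :: 'p mod_ring) \<noteq> 0" by (simp_all add: eq7)
  have "(B - 3 * T 1) * (B - 5 * T 1) = B\<^sup>2 - 8 * (T 1 * B) + 15 * (T 1)\<^sup>2"
    by (simp add: algebra_simps power2_eq_square)
  moreover have "(8 :: 'p mod_ring) = 1" "(15 :: 'p mod_ring) = 1" by (simp_all add: eq7)
  ultimately have "(B - 3 * T 1) * (B - 5 * T 1) = B\<^sup>2 - 1 * (T 1 * B) + 1 * (T 1)\<^sup>2" by (simp only:)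
  also have "\<dots> = (T 1)\<^sup>2 - T 1 * B + B\<^sup>2" by (simp add: algebra_simps)
  also have "\<dots> = 0" using quad by (simp only: B_def)
  finally have "(B - 3 * T 1) * (B - 5 * T 1) = 0" .
  then consider "B = 5 * T 1" | "B = 3 * T 1" by auto
  then show ?thesis
  proof cases
    case 1
    define s where "s = 5 / T 1"
    have "s ^ m = 1" by (simp add: s_def power_divide A) (simp add: m eq_neg_iff_add_eq_0 eq7)
    then have "dilation s \<circ> t \<in> G" by (intro comp dilation_in t_in)
    also have "dilation s \<circ> t = invol2"
      by (rule eq_if_eq_on_mod7[OF card7])
         (simp_all add: invol2_values[OF card7] nz T2 T3 T4 T5 T6 1 s_def A0 eq7)
    finally show ?thesis by blast
  next
    case 2
    define s where "s = 3 / T 1"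
    have "s ^ m = 1" by (simp add: s_def power_divide A) (simp add: m eq_neg_iff_add_eq_0 eq7)
    then have "dilation s \<circ> t \<in> G" by (intro comp dilation_in t_in)
    also have "dilation s \<circ> t = invol1"
      by (rule eq_if_eq_on_mod7[OF card7])
         (simp_all add: invol1_values[OF card7] nz T2 T3 T4 T5 T6 2 s_def A0 eq7)
    finally show ?thesis by blast
  qed
qed

lemma neg_recip_or_invol_in:
  "neg_recip \<in> G \<or> CARD('p) = 7 \<and> (invol1 \<in> G \<or> invol2 \<in> G)"
proof (cases "\<forall>s. s ^ m = 1 \<longrightarrow> \<sigma> s = s")
  case True
  then have id: "\<And>s. s ^ m = 1 \<Longrightarrow> \<sigma> s = s" by blast
  from trivial_\<sigma>_cases[OF id] show ?thesis
  proof
    assume "\<exists>C. \<forall>x. x \<noteq> 0 \<longrightarrow> T x = C / x"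
    then obtain C where "\<forall>x. x \<noteq> 0 \<longrightarrow> T x = C / x" ..
    then have "neg_recip \<in> G" by (intro neg_recip_in) simp
    then show ?thesis ..
  next
    assume *: "m = 3 \<and> T 1 ^ m = -1 \<and> (T 1)\<^sup>2 - T 1 * T (- 1) + (T (- 1))\<^sup>2 = 0"
    then have "CARD('p) = 7" using card by simp
    moreover have "invol1 \<in> G \<or> invol2 \<in> G" by (rule invol_in[OF id]) (use * in blast)+
    ultimately show ?thesis by simp
  qed
next
  case False
  then obtain s where "s ^ m = 1" "\<sigma> s \<noteq> s" by auto
  from eq_reciprocal_if_nontrivial[OF this] obtain C where "\<forall>x. x \<noteq> 0 \<longrightarrow> T x = C / x" ..
  then have "neg_recip \<in> G" by (intro neg_recip_in) simp
  then show ?thesis ..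
qed

end

context zp_perm_group
begin

lemma swappingI: "t \<in> G \<Longrightarrow> t None = Some 0 \<Longrightarrow> t (Some 0) = None \<Longrightarrow> swapping G m t"
  by (intro swapping.intro zp_perm_group_axioms swapping_axioms.intro)

lemma neg_recip_or_invol_in:
  "neg_recip \<in> G \<or> CARD('p) = 7 \<and> (invol1 \<in> G \<or> invol2 \<in> G)"
proof -
  obtain t where "t \<in> G" "t None = Some 0" "t (Some 0) = None" using ex_swap by blast
  then show ?thesis by (intro swapping.neg_recip_or_invol_in[OF swappingI])
qed

end

section \<open>Generators\<close>

lemma carrier_BijGroup: "carrier (BijGroup UNIV) = {f. bij f}"
  by (auto simp: BijGroup_def Bij_def)

lemma mult_BijGroup: "bij f \<Longrightarrow> bij g \<Longrightarrow> f \<otimes>\<^bsub>BijGroup UNIV\<^esub> g = f \<circ> g"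
  by (auto simp: BijGroup_def Bij_def compose_def)

lemma one_BijGroup: "\<one>\<^bsub>BijGroup UNIV\<^esub> = id"
  by (auto simp: BijGroup_def)

lemma inv_BijGroup:
  assumes "bij f"
  shows "inv\<^bsub>BijGroup UNIV\<^esub> f = inv_into UNIV f"
proof (rule group.inv_equality[OF group_BijGroup])
  have b: "bij (inv_into UNIV f)" using assms by (rule bij_imp_bij_inv)
  show "inv_into UNIV f \<otimes>\<^bsub>BijGroup UNIV\<^esub> f = \<one>\<^bsub>BijGroup UNIV\<^esub>"
    unfolding mult_BijGroup[OF b assms] one_BijGroup
    using assms by (simp add: bij_is_inj)
  show "f \<in> carrier (BijGroup UNIV)" "inv_into UNIV f \<in> carrier (BijGroup UNIV)"
    using assms b by (simp_all add: carrier_BijGroup)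
qed

context swapping
begin

lemma bruhat_decomposition:
  assumes g: "g \<in> G"
  shows "(\<exists>u a. a ^ m = 1 \<and> g = translation u \<circ> dilation a) \<or>
    (\<exists>u a v. a ^ m = 1 \<and> g = translation u \<circ> dilation a \<circ> t \<circ> translation v)"
proof (cases "g None")
  case None
  obtain a b where ab: "a \<noteq> 0" "g = translation b \<circ> dilation a" using affine[OF g None] by blast
  have "translation (- b) \<circ> g = dilation a" by (rule ext) (simp add: ab)
  then have "dilation a \<in> G" using comp[OF translation_in g, of "- b"] by (simp only:)
  then show ?thesis using ab dilation_in_iff[OF ab(1)] by blast
next
  case (Some u)
  have binv: "inv_into UNIV t (t z) = z" for z using bij_is_inj[OF bij[OF t_in]] by (rule inv_f_f)
  have t_inv: "t (inv_into UNIV t z) = z" for z using bij_is_surj[OF bij[OF t_in]] by (rule surj_f_inv_f)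
  obtain y where y: "g y = None" using bij_is_surj[OF bij[OF g]] by (metis surjD)
  then obtain v where v: "y = Some v" using Some by (cases y) auto
  let ?h = "translation (- u) \<circ> g \<circ> translation v \<circ> inv_into UNIV t"
  have "?h \<in> G" by (intro comp translation_in g inv_in t_in)
  moreover have "?h None = None" "?h (Some 0) = Some 0"
    using binv[of "Some 0"] binv[of None] y v Some by simp_all
  ultimately obtain a where a: "a ^ m = 1" "?h = dilation a" by (rule stabilizer_2)
  have "g = translation u \<circ> dilation a \<circ> t \<circ> translation (- v)"
  proof
    fix z
    have "dilation a (t (translation (- v) z)) = translation (- u) (g z)"
      using fun_cong[OF a(2), of "t (translation (- v) z)"] by (simp add: binv)
    then show "g z = (translation u \<circ> dilation a \<circ> t \<circ> translation (- v)) z" by simp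
  qed
  then show ?thesis using a(1) by blast
qed

lemma subset_if_closed:
  assumes closed: "\<And>f g. f \<in> H \<Longrightarrow> g \<in> H \<Longrightarrow> f \<circ> g \<in> H"
    and H: "\<And>u. translation u \<in> H" "\<And>a. a ^ m = 1 \<Longrightarrow> dilation a \<in> H" "t \<in> H"
  shows "G \<subseteq> H"
proof
  fix g assume "g \<in> G"
  from bruhat_decomposition[OF this] show "g \<in> H"
    by (elim disjE exE conjE) (simp_all only: closed H)
qed

end

context zp_perm_group
begin

lemma closed_generate:
  assumes "S \<subseteq> G" "f \<in> generate (BijGroup UNIV) S" "g \<in> generate (BijGroup UNIV) S"
  shows "f \<circ> g \<in> generate (BijGroup UNIV) S"
proof -
  have "S \<subseteq> carrier (BijGroup UNIV)" using assms(1) bij by (auto simp: carrier_BijGroup)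
  then have "generate (BijGroup UNIV) S \<subseteq> carrier (BijGroup UNIV)"
    by (rule group.generate_incl[OF group_BijGroup])
  then have "bij f" "bij g" using assms by (auto simp: carrier_BijGroup)
  then show ?thesis using generate.eng[OF assms(2,3)] by (simp add: mult_BijGroup)
qed

lemma translation_in_generate:
  assumes "S \<subseteq> G" "translation 1 \<in> S"
  shows "translation u \<in> generate (BijGroup UNIV) S"
proof -
  let ?H = "generate (BijGroup UNIV) S"
  have "translation (of_nat n) \<in> ?H" for n
  proof (induction n)
    case 0
    have "translation (of_nat 0) = (id :: 'p zp_inf \<Rightarrow> _)" by (rule ext) simp
    then show ?case using generate.one[of "BijGroup UNIV" S] by (simp only: one_BijGroup)
  next
    case (Suc n)
    have "translation (of_nat (Suc n)) = translation (of_nat n) \<circ> (translation 1 :: 'p zp_inf \<Rightarrow> _)"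
      by (rule ext) (simp add: add.commute)
    then show ?case using closed_generate[OF assms(1) Suc generate.incl[OF assms(2)]] by (simp only:)
  qed
  then show ?thesis using surj_of_nat_mod_ring[of u] by auto
qed

lemma subgroup_G: "subgroup G (BijGroup UNIV)"
proof
  show "G \<subseteq> carrier (BijGroup UNIV)" using bij by (auto simp: carrier_BijGroup)
  show "x \<otimes>\<^bsub>BijGroup UNIV\<^esub> y \<in> G" if "x \<in> G" "y \<in> G" for x y
    using that bij comp by (simp add: mult_BijGroup)
  have "translation 0 = (id :: 'p zp_inf \<Rightarrow> _)" by (rule ext) simp
  then show "\<one>\<^bsub>BijGroup UNIV\<^esub> \<in> G" using translation_in[of 0] by (simp only: one_BijGroup)
  show "inv\<^bsub>BijGroup UNIV\<^esub> x \<in> G" if "x \<in> G" for x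
    using that bij inv_in by (simp add: inv_BijGroup)
qed

lemma generate_subset: "S \<subseteq> G \<Longrightarrow> generate (BijGroup UNIV) S \<subseteq> G"
  by (rule group.generate_subgroup_incl[OF group_BijGroup _ subgroup_G])

lemma neg_recip_simps [simp]:
  "neg_recip None = Some 0" "neg_recip (Some 0) = None" "z \<noteq> 0 \<Longrightarrow> neg_recip (Some z) = Some (- (1 / z))"
  by (simp_all add: neg_recip_def)

text \<open>
  For \<open>t z = -1/z\<close> one has \<open>k (1/b) = b\<^sup>2\<close>, so the relation \<open>bruhat\<close>, solved for the dilation, writes
  every dilation by a square as a product of translations and \<open>t\<close>.
\<close>

lemma generate_neg_recip:
  assumes w: "neg_recip \<in> G"
  shows "G = generate (BijGroup UNIV) {translation 1, neg_recip}" (is "G = ?H")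
proof
  interpret swapping G m neg_recip by (rule swappingI) (simp_all add: w)
  have S: "{translation 1, neg_recip} \<subseteq> G" using translation_in w by simp
  note closed = closed_generate[OF S]
  have tr: "translation u \<in> ?H" for u by (rule translation_in_generate[OF S]) simp
  have nr: "neg_recip \<in> ?H" by (rule generate.incl) simp
  have Tx: "T x = - (1 / x)" if "x \<noteq> 0" for x
    using t_Some[OF that] that by (simp del: t_Some)
  show "G \<subseteq> ?H"
  proof (rule subset_if_closed[OF closed tr _ nr])
    fix a :: "'p mod_ring" assume a: "a ^ m = 1"
    then obtain b where b: "b \<noteq> 0" "a = b\<^sup>2" using card_residues(2)[OF card m_pos] by blast
    have c: "c (1 / b) = b" using c_T[of b] Tx[OF b(1)] by simp
    have k: "k (1 / b) = a" using k_eq[of "1 / b"] b by (simp add: c Tx power2_eq_square)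
    have nn: "neg_recip (neg_recip z) = z" for z :: "'p zp_inf"
      by (cases z) (auto simp: neg_recip_def)
    have "dilation a = translation b \<circ> (neg_recip \<circ> (translation (1 / b) \<circ> (neg_recip \<circ> (translation b \<circ> neg_recip))))"
    proof
      fix z
      have "neg_recip (translation (1 / b) (neg_recip (translation b (neg_recip z)))) =
          translation (- b) (dilation a (neg_recip (translation (- b) (translation b (neg_recip z)))))"
        using bruhat[of "1 / b" "translation b (neg_recip z)"] b by (simp add: c k Tx)
      then show "dilation a z = (translation b \<circ> (neg_recip \<circ> (translation (1 / b) \<circ> (neg_recip \<circ> (translation b \<circ> neg_recip))))) z"
        by (simp add: nn)
    qed
    then show "dilation a \<in> ?H" by (simp only: closed tr nr)
  qed
qed (rule generate_subset, use translation_in w in simp)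

end

section \<open>The action on lines\<close>

lemma vec2_eq_iff: "(v :: 'a ^ 2) = w \<longleftrightarrow> v $ 1 = w $ 1 \<and> v $ 2 = w $ 2"
  by (auto simp: vec_eq_iff forall_2)

lemma mat2_mult_vec:
  "((A :: 'a::comm_ring_1 ^ 2 ^ 2) *v v) $ i = A $ i $ 1 * v $ 1 + A $ i $ 2 * v $ 2"
  by (simp add: matrix_vector_mult_def sum_2)

text \<open>
  Homogeneous coordinates on the projective line, with \<open>z = (z : 1)\<close> and \<open>\<infinity> = (1 : 0)\<close>.
\<close>

definition homog :: "'p::prime_card zp_inf \<Rightarrow> 'p mod_ring ^ 2" where
  "homog x = (case x of None \<Rightarrow> vector [1, 0] | Some z \<Rightarrow> vector [z, 1])"

lemma homog_simps [simp]:
  "homog None $ 1 = 1" "homog None $ 2 = 0" "homog (Some z) $ 1 = z" "homog (Some z) $ 2 = 1"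
  by (simp_all add: homog_def)

definition line :: "'p::prime_card zp_inf \<Rightarrow> ('p mod_ring ^ 2) set" where
  "line x = range (\<lambda>c. c *s homog x)"

lemma homog_neq_0: "homog x \<noteq> 0"
  by (cases x) (auto simp: vec2_eq_iff)

lemma line_eq_span: "line x = vec.span {homog x}"
  by (simp add: line_def vec.span_singleton)

lemma line_in_lines: "line x \<in> lines"
  by (simp add: lines_def line_eq_span vec.subspace_span vec.dim_span homog_neq_0)

lemma inj_line: "inj (line :: 'p::prime_card zp_inf \<Rightarrow> _)"
proof
  fix x y :: "'p zp_inf" assume "line x = line y"
  then have "homog x \<in> line y"
    unfolding line_eq_span by (metis vec.span_base insertI1)
  then obtain c where "homog x = c *s homog y" by (auto simp: line_def)
  then show "x = y" by (cases x; cases y) (auto simp: vec2_eq_iff)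
qed

lemma ex_homog_multiple:
  assumes "w \<noteq> 0"
  shows "\<exists>x c. c \<noteq> 0 \<and> w = c *s homog x"
proof (cases "w $ 2 = 0")
  case True
  then have "w $ 1 \<noteq> 0" "w = (w $ 1) *s homog None" using assms by (auto simp: vec2_eq_iff)
  then show ?thesis by blast
next
  case False
  then have "w = (w $ 2) *s homog (Some (w $ 1 / w $ 2))" by (auto simp: vec2_eq_iff)
  then show ?thesis using False by blast
qed

lemma bij_betw_line: "bij_betw line (UNIV :: 'p::prime_card zp_inf set) lines"
proof (rule bij_betw_imageI[OF inj_line])
  show "range line = (lines :: ('p mod_ring ^ 2) set set)"
  proof
    show "range line \<subseteq> (lines :: ('p mod_ring ^ 2) set set)" using line_in_lines by blast
    show "lines \<subseteq> (range line :: ('p mod_ring ^ 2) set set)"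
    proof
      fix L :: "('p mod_ring ^ 2) set" assume "L \<in> lines"
      then have L: "vec.subspace L" "vec.dim L = 1" by (auto simp: lines_def)
      obtain B where B: "B \<subseteq> L" "vec.independent B" "L \<subseteq> vec.span B" "card B = vec.dim L"
        by (rule vec.basis_exists)
      then obtain w where w: "B = {w}" using L(2) by (auto simp: card_1_singleton_iff)
      have "w \<noteq> 0" using B(2) w by simp
      then obtain x c where x: "c \<noteq> 0" "w = c *s homog x" using ex_homog_multiple by blast
      have "L = vec.span {w}"
        using B w L(1) vec.span_minimal[of "{w}" L] by auto
      also have "\<dots> = line x"
      proof -
        have "d *s homog x = (d / c) *s w" "d *s w = (d * c) *s homog x" for d using x by simp_all
        then show ?thesis unfolding vec.span_singleton line_def by blast
      qed
      finally show "L \<in> range line" by blast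
    qed
  qed
qed

definition represents :: "'p::prime_card mod_ring ^ 2 ^ 2 \<Rightarrow> ('p zp_inf \<Rightarrow> 'p zp_inf) \<Rightarrow> bool" where
  "represents A g \<longleftrightarrow> (\<forall>x. \<exists>c. c \<noteq> 0 \<and> A *v homog x = c *s homog (g x))"

lemma representsI:
  assumes "a \<noteq> 0" "A *v homog None = a *s homog (g None)"
    and "\<And>z. b z \<noteq> 0" "\<And>z. A *v homog (Some z) = b z *s homog (g (Some z))"
  shows "represents A g"
  unfolding represents_def
proof
  fix x show "\<exists>c. c \<noteq> 0 \<and> A *v homog x = c *s homog (g x)"
    using assms by (cases x) blast+
qed

lemma represents_comp:
  assumes "represents A g" "represents B h"
  shows "represents (A ** B) (g \<circ> h)"
  unfolding represents_def
proof
  fix x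
  obtain c where c: "c \<noteq> 0" "B *v homog x = c *s homog (h x)"
    using assms(2) unfolding represents_def by blast
  obtain d where d: "d \<noteq> 0" "A *v homog (h x) = d *s homog (g (h x))"
    using assms(1) unfolding represents_def by blast
  have "(A ** B) *v homog x = A *v (B *v homog x)" by (simp add: matrix_vector_mul_assoc)
  also have "\<dots> = (c * d) *s homog (g (h x))"
    by (simp add: c(2) d(2) vector_scalar_commute)
  finally show "\<exists>c. c \<noteq> 0 \<and> (A ** B) *v homog x = c *s homog ((g \<circ> h) x)"
    using c d by (intro exI[of _ "c * d"]) simp
qed

lemma represents_uminus:
  assumes "represents A g"
  shows "represents (- A) g"
  unfolding represents_def
proof
  fix x
  obtain c where c: "c \<noteq> 0" "A *v homog x = c *s homog (g x)"
    using assms unfolding represents_def by blast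
  have "(- A) *v homog x = - (A *v homog x)" by (simp add: vec2_eq_iff mat2_mult_vec)
  also have "\<dots> = (- c) *s homog (g x)" by (simp add: c(2))
  finally have "(- A) *v homog x = (- c) *s homog (g x)" .
  then show "\<exists>c. c \<noteq> 0 \<and> (- A) *v homog x = c *s homog (g x)" using c(1) by (intro exI[of _ "- c"]) simp
qed

lemma image_line:
  assumes "represents A g"
  shows "(\<lambda>v. A *v v) ` line x = line (g x)"
proof -
  obtain c where c: "c \<noteq> 0" "A *v homog x = c *s homog (g x)"
    using assms unfolding represents_def by blast
  have 1: "A *v (d *s homog x) = (d * c) *s homog (g x)" for d
    by (simp add: c(2) vector_scalar_commute)
  have 2: "d *s homog (g x) = A *v ((d / c) *s homog x)" for d
    using 1[of "d / c"] c(1) by simp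
  show ?thesis unfolding line_def image_image using 1 2 by blast
qed

definition mat2 :: "'a \<Rightarrow> 'a \<Rightarrow> 'a \<Rightarrow> 'a \<Rightarrow> 'a ^ 2 ^ 2" where
  "mat2 a b c d = (\<chi> i j. if i = 1 then (if j = 1 then a else b) else (if j = 1 then c else d))"

lemma mat2_nth [simp]:
  "mat2 a b c d $ 1 $ 1 = a" "mat2 a b c d $ 1 $ 2 = b" "mat2 a b c d $ 2 $ 1 = c" "mat2 a b c d $ 2 $ 2 = d"
  by (simp_all add: mat2_def)

lemma det_mat2: "det (mat2 a b c (d :: 'a::comm_ring_1)) = a * d - b * c"
  by (simp add: det_2)

lemma carrier_PSL2: "carrier PSL2 = {{A, - A} | A :: 'p::prime_card mod_ring ^ 2 ^ 2. det A = 1}"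
proof -
  have "- mat 1 ** A = - A" for A :: "'p mod_ring ^ 2 ^ 2"
    by (simp add: vec2_eq_iff matrix_matrix_mult_def sum_2 mat_def)
  then show ?thesis
    by (auto simp: PSL2_def FactGroup_def RCOSETS_def r_coset_def SL2_def)
qed

context zp_perm_group
begin

lemma ex_matrix:
  assumes w: "neg_recip \<in> G" and g: "g \<in> G"
  shows "\<exists>A. det A = 1 \<and> represents A g"
proof -
  interpret swapping G m neg_recip by (rule swappingI) (simp_all add: w)
  let ?H = "{g :: 'p zp_inf \<Rightarrow> 'p zp_inf. \<exists>A. det A = 1 \<and> represents A g}"
  have "G \<subseteq> ?H"
  proof (rule subset_if_closed)
    show "f \<circ> g \<in> ?H" if fg: "f \<in> ?H" "g \<in> ?H" for f g
    proof -
      obtain A B where "det A = 1" "represents A f" "det B = 1" "represents B g" using fg by auto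
      then have "det (A ** B) = 1" "represents (A ** B) (f \<circ> g)"
        by (simp_all add: det_mul represents_comp)
      then show ?thesis by blast
    qed
    show "translation u \<in> ?H" for u
    proof -
      have "represents (mat2 1 u 0 1) (translation u)"
        by (rule representsI[where a = 1 and b = "\<lambda>_. 1"]) (simp_all add: vec2_eq_iff mat2_mult_vec)
      moreover have "det (mat2 1 u 0 1) = 1" by (simp add: det_mat2)
      ultimately show ?thesis by blast
    qed
    show "dilation a \<in> ?H" if "a ^ m = 1" for a
    proof -
      obtain b where b: "b \<noteq> 0" "a = b\<^sup>2" using card_residues(2)[OF card m_pos \<open>a ^ m = 1\<close>] by blast
      have "represents (mat2 b 0 0 (1 / b)) (dilation a)"
        by (rule representsI[where a = b and b = "\<lambda>_. 1 / b"])
           (use b in \<open>simp_all add: vec2_eq_iff mat2_mult_vec power2_eq_square\<close>)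
      moreover have "det (mat2 b 0 0 (1 / b)) = 1" using b by (simp add: det_mat2)
      ultimately show ?thesis by blast
    qed
    have "represents (mat2 0 (-1) 1 0) (neg_recip :: 'p zp_inf \<Rightarrow> _)"
    proof (rule representsI[where a = 1 and b = "\<lambda>z. if z = 0 then - 1 else z"])
      show "mat2 0 (-1) 1 0 *v homog (Some z) = (if z = 0 then - 1 else z) *s homog (neg_recip (Some z))"
        for z :: "'p mod_ring"
        by (cases "z = 0") (simp_all add: vec2_eq_iff mat2_mult_vec)
    qed (simp_all add: vec2_eq_iff mat2_mult_vec)
    moreover have "det (mat2 0 (-1) 1 (0 :: 'p mod_ring)) = 1" by (simp add: det_mat2)
    ultimately show "neg_recip \<in> ?H" by blast
  qed
  then show ?thesis using g by blast
qed

text \<open>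
  If the lower left entry \<open>c\<close> vanishes, the Moebius transformation of \<open>A\<close> is affine with square factor.
  Otherwise it is \<open>z \<mapsto> a/c - (1/c)\<^sup>2 / (z + d/c)\<close>, because \<open>a d - b c = 1\<close>.
\<close>

lemma ex_perm:
  fixes A :: "'p mod_ring ^ 2 ^ 2"
  assumes w: "neg_recip \<in> G" and A: "det A = 1"
  shows "\<exists>g\<in>G. represents A g"
proof -
  define a b c d where "a = A $ 1 $ 1" and "b = A $ 1 $ 2" and "c = A $ 2 $ 1" and "d = A $ 2 $ 2"
  have det: "a * d - b * c = 1" using A by (simp add: det_2 a_def b_def c_def d_def)
  have mult: "(A *v v) $ 1 = a * v $ 1 + b * v $ 2" "(A *v v) $ 2 = c * v $ 1 + d * v $ 2" for v
    by (simp_all add: mat2_mult_vec a_def b_def c_def d_def)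
  have dil: "dilation (s\<^sup>2) \<in> G" if "s \<noteq> 0" for s
    using power_half_cases(2)[OF card that] by (intro dilation_in) (simp flip: power_mult)
  show ?thesis
  proof (cases "c = 0")
    case True
    then have ad: "a * d = 1" using det by simp
    then have a0: "a \<noteq> 0" and d: "d = 1 / a" by (auto simp: eq_divide_eq mult.commute)
    have "represents A (translation (a * b) \<circ> dilation (a\<^sup>2))"
      by (rule representsI[where a = a and b = "\<lambda>_. d"])
         (use a0 in \<open>simp_all add: vec2_eq_iff mult True d power2_eq_square field_simps\<close>)
    moreover have "translation (a * b) \<circ> dilation (a\<^sup>2) \<in> G"
      using a0 by (intro comp translation_in dil)
    ultimately show ?thesis by blast
  next
    case False
    let ?g = "translation (a / c) \<circ> (dilation ((1 / c)\<^sup>2) \<circ> (neg_recip \<circ> translation (d / c)))"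
    have "represents A ?g"
    proof (rule representsI[where a = c and b = "\<lambda>z. if c * z + d = 0 then - 1 / c else c * z + d"])
      show "c \<noteq> 0" by (rule False)
      show "A *v homog None = c *s homog (?g None)"
        using False by (simp add: vec2_eq_iff mult)
      show "(if c * z + d = 0 then - 1 / c else c * z + d) \<noteq> 0" for z using False by simp
      show "A *v homog (Some z) = (if c * z + d = 0 then - 1 / c else c * z + d) *s homog (?g (Some z))" for z
      proof (cases "c * z + d = 0")
        case True
        then have z: "z + d / c = 0" using False by (simp add: add_divide_eq_iff mult.commute)
        have "c * (a * z + b) = a * (c * z + d) - (a * d - b * c)" by (simp add: algebra_simps)
        then have e: "c * (a * z + b) = -1" by (simp only: True det) simp
        have "a * z + b = (c * (a * z + b)) / c" using False by simp
        then have "a * z + b = - 1 / c" by (simp only: e)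
        then show ?thesis using z True False by (simp add: vec2_eq_iff mult)
      next
        case nz: False
        have z: "z + d / c = (c * z + d) / c" using False by (simp add: add_divide_distrib)
        then have z0: "z + d / c \<noteq> 0" unfolding z divide_eq_0_iff using nz False by blast
        have "1 / (z + d / c) = c / (c * z + d)" unfolding z by simp
        then have "?g (Some z) = Some ((1 / c)\<^sup>2 * - (c / (c * z + d)) + a / c)"
          using neg_recip_simps(3)[OF z0] by simp
        also have "(1 / c)\<^sup>2 * - (c / (c * z + d)) = - (1 / (c * (c * z + d)))"
          using False nz by (simp add: power2_eq_square)
        finally have "?g (Some z) = Some (a / c - 1 / (c * (c * z + d)))" by simp
        moreover have "a * z + b = (c * z + d) * (a / c - 1 / (c * (c * z + d)))"
        proof -
          have "c * (a * z + b) = a * (c * z + d) - (a * d - b * c)" by (simp add: algebra_simps)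
          then have e: "c * (a * z + b) = a * (c * z + d) - 1" by (simp only: det)
          have "a * z + b = (c * (a * z + b)) / c" using False by simp
          also have "\<dots> = (a * (c * z + d) - 1) / c" by (simp only: e)
          also have "\<dots> = (c * z + d) * (a / c - 1 / (c * (c * z + d)))"
            using False nz by (simp add: right_diff_distrib diff_divide_distrib mult.commute)
          finally show ?thesis .
        qed
        moreover have "A *v homog (Some z) = (c * z + d) *s homog (Some y)" if "a * z + b = (c * z + d) * y" for y
          by (simp only: vec2_eq_iff mult vector_smult_component homog_simps mult_1_right that)
        ultimately show ?thesis using nz by (simp only: if_False)
      qed
    qed
    moreover have "?g \<in> G" using False by (intro comp translation_in dil w) simp
    ultimately show ?thesis by blast
  qed
qed

lemma perm_isomorphic_PSL2:
  assumes w: "neg_recip \<in> G"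
  shows "perm_isomorphic UNIV G (lines :: ('p mod_ring ^ 2) set set) PSL2_perms"
proof -
  let ?conj = "\<lambda>g. \<lambda>L\<in>lines. line (g (inv_into UNIV line L))"
  have conj: "?conj g = PSL2_action {A, - A}" if A: "represents A g" for A :: "'p mod_ring ^ 2 ^ 2" and g
  proof
    fix L show "?conj g L = PSL2_action {A, - A} L"
    proof (cases "L \<in> lines")
      case True
      obtain x where x: "L = line x" using True bij_betw_line by (auto simp: bij_betw_def)
      have "inv_into UNIV line L = x" unfolding x by (rule inv_f_f[OF inj_line])
      then show ?thesis
        using True image_line[OF A, of x] image_line[OF represents_uminus[OF A], of x]
        by (simp add: PSL2_action_def x)
    qed (simp add: PSL2_action_def)
  qed
  have "?conj ` G = PSL2_perms"
  proof
    show "?conj ` G \<subseteq> PSL2_perms"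
      using ex_matrix[OF w] conj by (fastforce simp: PSL2_perms_def carrier_PSL2)
    show "PSL2_perms \<subseteq> ?conj ` G"
    proof
      fix f assume "f \<in> (PSL2_perms :: (('p mod_ring ^ 2) set \<Rightarrow> _) set)"
      then obtain A :: "'p mod_ring ^ 2 ^ 2" where A: "det A = 1" "f = PSL2_action {A, - A}"
        by (auto simp: PSL2_perms_def carrier_PSL2)
      obtain g where g: "g \<in> G" "represents A g" using ex_perm[OF w A(1)] by blast
      show "f \<in> ?conj ` G" unfolding A(2) conj[OF g(2), symmetric] using g(1) by (rule imageI)
    qed
  qed
  then show ?thesis unfolding perm_isomorphic_def using bij_betw_line by blast
qed

end

context swapping
begin

section \<open>The normal subgroup in the exceptional case\<close>

text \<open>
  The subgroup \<open>N\<close> consists of the identity and the conjugates \<open>n b\<close> of the involution \<open>t\<close> by translations.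
  The hypotheses on \<open>k\<close> and \<open>c\<close> reduce the relation \<open>bruhat\<close> to \<open>t \<circ> n b = n (T b)\<close>, which makes \<open>N\<close>
  closed under composition. Translations permute the \<open>n b\<close>, and so do dilations, since they commute
  with \<open>t\<close>; together with \<open>t\<close> these generate \<open>G\<close>.
\<close>

lemma normal_subgroup:
  assumes inv: "\<And>z. t (t z) = z" and \<sigma>: "\<And>s. s ^ m = 1 \<Longrightarrow> \<sigma> s = s"
    and k: "\<And>b. b \<noteq> 0 \<Longrightarrow> k b = 1" and Tc: "\<And>b. b \<noteq> 0 \<Longrightarrow> c b + b = T b"
  shows "\<exists>N. N \<lhd> BijGroup UNIV\<lparr>carrier := G\<rparr> \<and> card N = 2 * m + 2"
proof -
  define n where "n b = translation b \<circ> t \<circ> translation (- b)" for b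
  define N where "N = insert id (range n)"
  have n_None: "n b None = Some b" for b by (simp add: n_def)
  have n_in: "n b \<in> G" for b unfolding n_def by (intro comp translation_in t_in)
  have id_in: "id \<in> G"
    using subgroup.one_closed[OF subgroup_G] by (simp only: one_BijGroup)
  have N_sub: "N \<subseteq> G" using n_in id_in by (auto simp: N_def)
  have n_n: "n b \<circ> n b = id" for b by (rule ext) (simp add: n_def inv)
  have t_n: "t \<circ> n b = n (T b)" if "b \<noteq> 0" for b
  proof
    fix z
    have "(t \<circ> n b) z = translation (T b) (t (translation (- c b - b) z))"
      using bruhat[OF that, of "translation (- b) z"] by (simp add: n_def k[OF that])
    also have "- c b - b = - T b" using Tc[OF that] by (simp add: algebra_simps)
    finally show "(t \<circ> n b) z = n (T b) z" by (simp add: n_def)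
  qed
  have tr_n: "translation u \<circ> n b = n (b + u) \<circ> translation u" for u b
    by (rule ext) (simp add: n_def add.commute)
  have n_n_ne: "n a \<circ> n b = n (a + T (b - a))" if "a \<noteq> b" for a b
  proof
    fix z
    have "n a (n b z) = translation a (t (n (b - a) (translation (- a) z)))"
      using fun_cong[OF tr_n[of "- a" b], of z] by (simp add: n_def)
    also have "\<dots> = translation a (n (T (b - a)) (translation (- a) z))"
      using fun_cong[OF t_n[of "b - a"], of "translation (- a) z"] that by simp
    also have "\<dots> = n (a + T (b - a)) z"
      using fun_cong[OF tr_n[of a "T (b - a)"], of "translation (- a) z"] by (simp add: add.commute)
    finally show "(n a \<circ> n b) z = n (a + T (b - a)) z" by simp
  qed
  have N_comp: "f \<circ> g \<in> N" if "f \<in> N" "g \<in> N" for f g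
  proof -
    have "n a \<circ> n b \<in> N" for a b
      by (cases "a = b") (simp_all only: n_n n_n_ne N_def insert_iff rangeI simp_thms)
    then show ?thesis using that by (auto simp: N_def)
  qed
  have N_inv: "inv_into UNIV f = f" if "f \<in> N" for f
  proof -
    have ff: "f (f z) = z" for z
      using that fun_cong[OF n_n, of _ z] by (auto simp: N_def)
    show ?thesis by (rule ext) (metis bij_is_inj bij N_sub that subsetD ff inv_f_f)
  qed
  have t_N: "n 0 = t" by (rule ext) (simp add: n_def)
  have dil_n: "dilation s \<circ> n b = n (s * b) \<circ> dilation s" if "s ^ m = 1" for s b
  proof
    fix z show "(dilation s \<circ> n b) z = (n (s * b) \<circ> dilation s) z"
      using t_dilation(2)[OF that, of "translation (- b) z"]
      by (simp add: n_def dilation_translation \<sigma>[OF that])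
  qed
  have t_conj: "\<exists>f'\<in>N. t \<circ> f = f' \<circ> t" if f: "f \<in> N" for f
  proof -
    have "t \<circ> f \<circ> t \<in> N" using N_comp t_N f by (metis N_def insertI2 rangeI)
    moreover have "t \<circ> f = (t \<circ> f \<circ> t) \<circ> t" by (rule ext) (simp add: inv)
    ultimately show ?thesis by blast
  qed
  let ?H = "{g. \<forall>f\<in>N. \<exists>f'\<in>N. g \<circ> f = f' \<circ> g}"
  have conj: "G \<subseteq> ?H"
  proof (rule subset_if_closed)
    show "g \<circ> h \<in> ?H" if gh: "g \<in> ?H" "h \<in> ?H" for g h
    proof (clarify)
      fix f assume "f \<in> N"
      then obtain f' where f': "f' \<in> N" "h \<circ> f = f' \<circ> h" using gh(2) by blast
      then obtain f'' where f'': "f'' \<in> N" "g \<circ> f' = f'' \<circ> g" using gh(1) by blast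
      have "g \<circ> h \<circ> f = f'' \<circ> (g \<circ> h)" using f'(2) f''(2) by (metis comp_assoc)
      then show "\<exists>f'\<in>N. g \<circ> h \<circ> f = f' \<circ> (g \<circ> h)" using f''(1) by blast
    qed
    show "translation u \<in> ?H" for u
      using tr_n by (auto simp: N_def)
    show "dilation a \<in> ?H" if "a ^ m = 1" for a
      using dil_n[OF that] by (auto simp: N_def)
    show "t \<in> ?H" using t_conj by blast
  qed
  interpret sub: group "BijGroup UNIV\<lparr>carrier := G\<rparr>"
    by (rule subgroup.subgroup_is_group[OF subgroup_G group_BijGroup])
  have "subgroup N (BijGroup UNIV)"
  proof
    show "N \<subseteq> carrier (BijGroup UNIV)" using N_sub bij by (auto simp: carrier_BijGroup)
    show "x \<otimes>\<^bsub>BijGroup UNIV\<^esub> y \<in> N" if "x \<in> N" "y \<in> N" for x y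
      using that bij N_sub N_comp by (simp add: mult_BijGroup subset_iff)
    show "\<one>\<^bsub>BijGroup UNIV\<^esub> \<in> N" by (simp only: one_BijGroup N_def insertI1)
    show "inv\<^bsub>BijGroup UNIV\<^esub> x \<in> N" if "x \<in> N" for x
      using that bij N_sub N_inv by (simp add: inv_BijGroup subset_iff)
  qed
  then have "subgroup N (BijGroup UNIV\<lparr>carrier := G\<rparr>)"
    by (rule group.subgroup_incl[OF group_BijGroup _ subgroup_G N_sub])
  moreover have "x \<otimes>\<^bsub>BijGroup UNIV\<lparr>carrier := G\<rparr>\<^esub> h \<otimes>\<^bsub>BijGroup UNIV\<lparr>carrier := G\<rparr>\<^esub> inv\<^bsub>BijGroup UNIV\<lparr>carrier := G\<rparr>\<^esub> x \<in> N"
    if x: "x \<in> carrier (BijGroup UNIV\<lparr>carrier := G\<rparr>)" and h: "h \<in> N" for x h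
  proof -
    have xG: "x \<in> G" and hG: "h \<in> G" using x h N_sub by auto
    obtain h' where h': "h' \<in> N" "x \<circ> h = h' \<circ> x" using conj xG h by blast
    have inv_x: "inv\<^bsub>BijGroup UNIV\<lparr>carrier := G\<rparr>\<^esub> x = inv_into UNIV x"
      using group.m_inv_consistent[OF group_BijGroup subgroup_G xG] inv_BijGroup[OF bij[OF xG]] by simp
    have b: "bij x" "bij h" "bij (x \<circ> h)" "bij (inv_into UNIV x)"
      using bij xG hG comp inv_in by blast+
    have "x \<otimes>\<^bsub>BijGroup UNIV\<^esub> h \<otimes>\<^bsub>BijGroup UNIV\<^esub> inv_into UNIV x = x \<circ> h \<circ> inv_into UNIV x"
      using b by (simp add: mult_BijGroup)
    also have "\<dots> = h'" using h'(2) bij_is_surj[OF b(1)] by (simp add: comp_assoc fun_eq_iff surj_f_inv_f)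
    finally show ?thesis using h'(1) by (simp add: inv_x)
  qed
  ultimately have "N \<lhd> BijGroup UNIV\<lparr>carrier := G\<rparr>"
    using sub.normal_inv_iff by blast
  moreover have "card N = 2 * m + 2"
  proof -
    have "inj n" using n_None by (metis injI option.inject)
    then have "card (range n) = 2 * m + 1" using card by (simp add: card_image)
    moreover have "id \<notin> range n"
    proof
      assume "id \<in> range n"
      then obtain b where "id = n b" by auto
      then have "id None = Some b" using n_None by metis
      then show False by simp
    qed
    ultimately show ?thesis by (simp add: N_def)
  qed
  ultimately show ?thesis by blast
qed

end

context zp_perm_group
begin

text \<open>
  The residues modulo \<open>7\<close> are \<open>1\<close>, \<open>2\<close> and \<open>4\<close>, so the dilation by \<open>2\<close> generates the dilations in \<open>G\<close>. The
  hypotheses of \<open>normal_subgroup\<close> are checked on the table of values of the involution.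
\<close>

lemma invol_case:
  assumes card7: "CARD('p) = 7" and s: "s \<in> {invol1, invol2}" "s \<in> G"
  shows "G = generate (BijGroup UNIV) {translation 1, dilation 2, s}"
    and "\<exists>N. N \<lhd> BijGroup UNIV\<lparr>carrier := G\<rparr> \<and> card N = 8"
proof -
  have m: "m = 3" using card card7 by simp
  note eq7 = numeral_eq_mod7[OF card7]
  note vals = invol1_values[OF card7] invol2_values[OF card7]
  have s_None: "s None = Some 0" "s (Some 0) = None" using s(1) vals by auto
  have inv: "s (s z) = z" for z
  proof (cases z)
    case (Some x)
    then show ?thesis using s(1) vals by (cases x rule: mod7_cases[OF card7]) auto
  qed (simp add: s_None)
  interpret swapping G m s by (rule swappingI) (fact s(2) s_None)+
  have K: "a = 1 \<or> a = 2 \<or> a = 2 * 2" if "a ^ m = 1" for a :: "'p mod_ring"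
  proof (cases a rule: mod7_cases[OF card7])
    case 4 with that show ?thesis by (simp add: m eq7)
  next
    case 6 with that show ?thesis by (simp add: m eq7)
  next
    case 7 with that show ?thesis by (simp add: m eq7)
  qed (use that m in simp_all)
  have K2: "(2 :: 'p mod_ring) ^ m = 1" by (simp add: m eq7)
  let ?S = "{translation 1, dilation 2, s}"
  have S: "?S \<subseteq> G" using translation_in dilation_in[OF K2] s(2) by simp
  show "G = generate (BijGroup UNIV) ?S"
  proof
    note closed = closed_generate[OF S]
    have d2: "dilation 2 \<in> generate (BijGroup UNIV) ?S" by (rule generate.incl) simp
    show "G \<subseteq> generate (BijGroup UNIV) ?S"
    proof (rule subset_if_closed[OF closed])
      show "translation u \<in> generate (BijGroup UNIV) ?S" for u
        by (rule translation_in_generate[OF S]) simp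
      show "s \<in> generate (BijGroup UNIV) ?S" by (rule generate.incl) simp
      fix a :: "'p mod_ring" assume "a ^ m = 1"
      from K[OF this] show "dilation a \<in> generate (BijGroup UNIV) ?S"
      proof (elim disjE)
        assume "a = 1"
        moreover have "dilation 1 = (id :: 'p zp_inf \<Rightarrow> _)" by (rule ext) simp
        ultimately show ?thesis using generate.one[of "BijGroup UNIV" ?S] by (simp only: one_BijGroup)
      next
        assume "a = 2 * 2"
        moreover have "dilation (2 * 2) = (dilation 2 \<circ> dilation 2 :: 'p zp_inf \<Rightarrow> _)" by (rule ext) simp
        ultimately show ?thesis using closed[OF d2 d2] by (simp only:)
      qed (use d2 in simp)
    qed
  qed (rule generate_subset[OF S])
  have nz: "(2 :: 'p mod_ring) \<noteq> 0" "(3 :: 'p mod_ring) \<noteq> 0" "(4 :: 'p mod_ring) \<noteq> 0"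
    "(5 :: 'p mod_ring) \<noteq> 0" "(6 :: 'p mod_ring) \<noteq> 0" by (simp_all add: eq7)
  have neg: "- 1 = (6 :: 'p mod_ring)" "- 2 = (5 :: 'p mod_ring)" "- 3 = (4 :: 'p mod_ring)"
    "- 4 = (3 :: 'p mod_ring)" "- 5 = (2 :: 'p mod_ring)" "- 6 = (1 :: 'p mod_ring)"
    by (simp_all add: neg_eq_iff_add_eq_0 eq7)
  have sT: "s (Some x) = Some (T x)" if "x \<noteq> 0" for x using that by (rule t_Some)
  have TT: "T (T x) = x" if "x \<noteq> 0" for x using inv[of "Some x"] that by simp
  have T_vals: "T 1 = 3 \<and> T 2 = 6 \<and> T 3 = 1 \<and> T 4 = 5 \<and> T 5 = 4 \<and> T 6 = 2 \<or>
      T 1 = 5 \<and> T 2 = 3 \<and> T 3 = 2 \<and> T 4 = 6 \<and> T 5 = 1 \<and> T 6 = 4"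
    using s(1)
  proof (elim insertE)
    assume "s = invol1"
    then show ?thesis using sT[of 1] sT[of 2] sT[of 3] sT[of 4] sT[of 5] sT[of 6] vals nz by simp
  next
    assume "s = invol2"
    then show ?thesis using sT[of 1] sT[of 2] sT[of 3] sT[of 4] sT[of 5] sT[of 6] vals nz by simp
  qed simp
  have c: "c x = T (- x)" if "x \<noteq> 0" for x
  proof -
    have "T (T (- x)) = T (c x)" using TT[of "- x"] that by simp
    then show ?thesis by (simp only: T_inj)
  qed
  have all: "k b = 1 \<and> c b + b = T b" if b: "b \<noteq> 0" for b
  proof -
    have "T (- T (- b)) = - T b \<and> T (- b) + b = T b"
      using T_vals b by (cases b rule: mod7_cases[OF card7]) (auto simp: neg eq7)
    then show ?thesis using k_eq[OF b] b by (simp add: c[OF b])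
  qed
  have "\<exists>N. N \<lhd> BijGroup UNIV\<lparr>carrier := G\<rparr> \<and> card N = 2 * m + 2"
  proof (rule normal_subgroup[OF inv])
    show "\<sigma> a = a" if "a ^ m = 1" for a
      using K[OF that] T_vals by (auto simp: \<sigma>_def divide_eq_eq eq7)
  qed (use all in blast)+
  then show "\<exists>N. N \<lhd> BijGroup UNIV\<lparr>carrier := G\<rparr> \<and> card N = 8" using m by simp
qed

end

section \<open>The theorem\<close>

theorem mainTheorem1:
  fixes G :: "('p::prime_card zp_inf \<Rightarrow> 'p zp_inf) set"
  assumes "CARD('p) \<noteq> 2"
    and "subgroup G (BijGroup UNIV)"
    and "transitive_on UNIV G"
    and "card G = (CARD('p) ^ 3 - CARD('p)) div 2"
    and "\<forall>a. translation a \<in> G"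
  shows "(neg_recip \<in> G \<or> CARD('p) = 7 \<and> (invol1 \<in> G \<or> invol2 \<in> G))
    \<and> (neg_recip \<in> G \<longrightarrow>
         G = generate (BijGroup UNIV) {translation 1, neg_recip}
         \<and> perm_isomorphic UNIV G (lines :: ('p mod_ring ^ 2) set set) PSL2_perms)
    \<and> (\<forall>\<sigma>\<in>{invol1, invol2}. CARD('p) = 7 \<and> \<sigma> \<in> G \<longrightarrow>
         G = generate (BijGroup UNIV) {translation 1, dilation 2, \<sigma>}
         \<and> (\<exists>N. N \<lhd> BijGroup UNIV\<lparr>carrier := G\<rparr> \<and> card N = 8))"
proof -
  have prime: "Factorial_Ring.prime CARD('p)" by (rule prime_card)
  then have "odd CARD('p)"
    using assms(1) prime_odd_nat[OF prime] prime_ge_2_nat[OF prime] by linarith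
  then obtain m where m: "CARD('p) = 2 * m + 1" by (rule oddE)
  have "m \<noteq> 0" using prime_gt_1_nat[OF prime] m by simp
  have G_bij: "bij g" if "g \<in> G" for g
    using subgroup.mem_carrier[OF assms(2) that] by (simp add: carrier_BijGroup)
  interpret zp_perm_group G m
  proof
    show "CARD('p) = 2 * m + 1" by (rule m)
    show "0 < m" using \<open>m \<noteq> 0\<close> by simp
    show "bij g" if "g \<in> G" for g using that by (rule G_bij)
    show "g \<circ> h \<in> G" if "g \<in> G" "h \<in> G" for g h
      using subgroup.m_closed[OF assms(2) that] that by (simp add: mult_BijGroup G_bij)
    show "inv_into UNIV g \<in> G" if "g \<in> G" for g
      using subgroup.m_inv_closed[OF assms(2) that] that by (simp add: inv_BijGroup G_bij)
    show "\<exists>g\<in>G. g x = y" for x y using assms(3) by (simp add: transitive_on_def)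
    have "CARD('p) ^ 3 - CARD('p) = 2 * ((2 * m + 2) * ((2 * m + 1) * m))"
      by (simp add: m power3_eq_cube algebra_simps)
    then show "card G = (2 * m + 2) * ((2 * m + 1) * m)" using assms(4) by simp
    show "translation a \<in> G" for a using assms(5) by simp
  qed
  show ?thesis
    using neg_recip_or_invol_in generate_neg_recip perm_isomorphic_PSL2 invol_case by blast
qed

end
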